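(* Let $q$ be a prime power and let $f:\{0\}\cup\{q^k:k\ge0\}\to\mathbb{R}^+$ be a function. Let $$W_q(t,f)=\Big\{\Theta(t)\in\mathbb{I}:\ \inf_{N(t)\in\mathbb{F}_q[t]\setminus\{0\}}f(|N(t)|)\cdot|N(t)|\cdot|\langle\Theta(t)\cdot N(t)\rangle|\cdot|N(t)|_{t}=0\Big\}.$$ Then $$\mu(W_q(t,f))=\begin{cases}0&\text{if }\sum_{k\ge0}\frac{k}{f(q^k)}<\infty,\\[2pt]1&\text{if }\sum_{k\ge0}\frac{k}{f(q^k)}=\infty\text{ and }f\text{ is non-decreasing.}\end{cases}$$
   Context: $\mathbb{F}_q$ is the finite field with $q$ elements and $\mathbb{F}_q((t^{-1}))$ is the field of formal Laurent series $\Theta(t)=\sum_{i\ge -h}a_it^{-i}$ over $\mathbb{F}_q$. If $a_{-h}\ne0$ then $|\Theta(t)|=q^{h}$ (and $|0|=0$). The fractional part is $\langle\Theta(t)\rangle=\sum_{i\ge1}a_it^{-i}$. The unit interval is $\mathbb{I}=\{\Theta\in\mathbb{F}_q((t^{-1})):|\Theta|<1\}$. For nonzero $N(t)\in\mathbb{F}_q[t]$, $|N(t)|_t=q^{-i}$ with $i=\max\{j\ge0:t^j\mid N(t)\}$. $\mu$ is the Haar measure on $\mathbb{F}_q((t^{-1}))$ normalised so that $\mu(\mathbb{I})=1$; equivalently, for $l\ge0$, the set of $\Phi\in\mathbb{I}$ whose coefficients of $t^{-1},\dots,t^{-l}$ agree with those of a given $\Theta\in\mathbb{I}$ has measure $q^{-l}$.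 $\mathbb{R}^+$ denotes the positive reals. *)

theory Defs
  imports "HOL-Analysis.Analysis" "HOL-Computational_Algebra.Formal_Laurent_Series"
begin

text \<open>
  The finite field is a type \<open>'a :: {field, finite}\<close>, so \<open>q\<close> is \<open>CARD('a)\<close>.
  The field of Laurent series in the inverse of \<open>t\<close> is \<open>'a fls\<close>, where the formal
  variable \<^const>\<open>fls_X\<close> plays the role of the inverse of \<open>t\<close>. Hence \<open>t\<close> itself is
  \<^const>\<open>fls_X_inv\<close>, and \<open>fls_nth \<Theta> i\<close> is the coefficient of \<open>t\<close> to the power \<open>-i\<close>.
\<close>

definition laurent_abs :: "'a::{field,finite} fls \<Rightarrow> real" where
  "laurent_abs \<Theta> = (if \<Theta> = 0 then 0 else real CARD('a) powi (- fls_subdegree \<Theta>))"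

definition laurent_of_poly :: "'a::field poly \<Rightarrow> 'a fls" where
  "laurent_of_poly N = poly (map_poly fls_const N) fls_X_inv"

definition frac_part :: "'a::field fls \<Rightarrow> 'a fls" where
  "frac_part \<Theta> = fps_to_fls (Abs_fps (\<lambda>i. if i = 0 then 0 else fls_nth \<Theta> (int i)))"

definition unit_interval :: "'a::{field,finite} fls set" where
  "unit_interval = {\<Theta>. laurent_abs \<Theta> < 1}"

text \<open>Only meaningful for \<open>N \<noteq> 0\<close>; \<open>[:0, 1:]\<close> is the polynomial \<open>t\<close>.\<close>

definition t_abs :: "'a::{field,finite} poly \<Rightarrow> real" where
  "t_abs N = real CARD('a) powi (- int (Max {j. [:0, 1:] ^ j dvd N}))"

text \<open>
  Haar measures on the Borel sets of an additive abelian topological group.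
  Regularity is not demanded: on a second countable locally compact group, such as
  \<open>'a fls\<close> for finite \<open>'a\<close>, it follows from finiteness on compact sets.
  The topology on \<open>'a fls\<close> is the one of the library, induced by a metric with base 2;
  it is also the topology induced by \<^const>\<open>laurent_abs\<close>.
\<close>

definition haar_measure :: "'a::{topological_space,ab_group_add} measure \<Rightarrow> bool" where
  "haar_measure \<mu> \<longleftrightarrow>
     sets \<mu> = sets borel \<and>
     (\<forall>x. \<forall>A\<in>sets borel. emeasure \<mu> ((+) x ` A) = emeasure \<mu> A) \<and>
     (\<forall>K\<in>sets borel. compact K \<longrightarrow> emeasure \<mu> K < \<infinity>) \<and>
     emeasure \<mu> UNIV \<noteq> 0"

text \<open>The domain of \<open>f\<close>, that is, the set of values of \<^const>\<open>laurent_abs\<close> on polynomials.\<close>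

definition poly_abs_values :: "nat \<Rightarrow> real set" where
  "poly_abs_values q = {0} \<union> range (\<lambda>k::nat. real q ^ k)"

definition W :: "(real \<Rightarrow> real) \<Rightarrow> 'a::{field,finite} fls set" where
  "W f = {\<Theta> \<in> unit_interval.
     (INF N\<in>UNIV - {0}.
        f (laurent_abs (laurent_of_poly N)) * laurent_abs (laurent_of_poly N) *
        laurent_abs (frac_part (\<Theta> * laurent_of_poly N)) * t_abs N) = 0}"

end

theory Submission
  imports Defs "HOL-Probability.Probability_Measure"
begin

text \<open>
  For \<open>N = t^v M\<close> with \<open>M(0) \<noteq> 0\<close> the condition on \<open>N\<close> says that \<open>\<langle>\<Theta> N\<rangle>\<close> is at most about
  \<open>1 / (f(|N|) |M|)\<close>, an event of that probability. There are \<open>k + 1\<close> choices of \<open>v\<close> in degree \<open>k\<close>, so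
  the convergence case is a union bound.

  For the divergence case, keep only those \<open>\<Theta>\<close> whose approximation \<open>Q/N\<close> is reduced. Two reduced
  fractions with different monic denominators are so far apart that the corresponding events are
  either disjoint or, by solving for \<open>\<Theta>\<close>, independent up to the reducedness condition. The second
  moment method therefore bounds the measure of the union below by a constant. Using only
  multiples of \<open>t^L\<close>, the union is equidistributed among the balls of radius \<open>q^-L\<close>, and an open set
  that fills a fixed proportion of every ball has full measure.
\<close>

subsection \<open>Laurent series, polynomials and rational approximation\<close>

text \<open>Reducedness is imposed because of overlaps. Let N = g a and N' = g b with a, b coprime
  and required precisions s, s'. The measure of the intersection obeys the product bound if s \<le>
  degree b or s' \<le> degree a. With a large common factor g both may fail, and the plain
  approximation sets are then strongly correlated. For reduced fractions with distinct monic
  denominators the sets are disjoint as soon as s \<ge> degree b and s' \<ge> degree a, so the two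
  cases cover everything. The price is a lower bound for the number of reduced numerators. A single
  N need not have a fixed proportion of them, but for N = t^(v+1) M the average over the monic M of
  given degree prime to t is at least (1 - 1/q)^2 \<ge> 1/4. This 1/4 is the c of the second moment
  bound, and c^2 / 2 gives the constant 1/32. It does not depend on L, which is what permits
  localisation to balls of radius q^-L. Absolute values are discrete, so in the divergence case
  f(q^k) / \<epsilon> is replaced by a power q^(l k), with one exponent function l for each
  \<epsilon>.\<close>

lemma card_field_ge_2: "2 \<le> CARD('a::{field,finite})"
  using card_mono[of "UNIV::'a set" "{0,1}"] by simp

text \<open>The ball |\<Theta>| < q^-s. In this indexing \<open>vball 0\<close> is the unit interval
  and \<open>vball (int n)\<close> has measure q^-n. Balls are additive subgroups, so measures can
  be found by counting cosets.\<close>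

definition vball :: "int \<Rightarrow> 'a::zero fls set" where
  "vball s = {\<Theta>. \<forall>i\<le>s. fls_nth \<Theta> i = 0}"

lemma vball_iff: "\<Theta> \<in> vball s \<longleftrightarrow> \<Theta> = 0 \<or> s < fls_subdegree \<Theta>"
proof
  assume "\<Theta> \<in> vball s"
  then show "\<Theta> = 0 \<or> s < fls_subdegree \<Theta>"
    unfolding vball_def using nth_fls_subdegree_nonzero by fastforce
next
  assume "\<Theta> = 0 \<or> s < fls_subdegree \<Theta>"
  then show "\<Theta> \<in> vball s"
    unfolding vball_def by auto
qed

lemma vball_zero [simp]: "0 \<in> vball s"
  by (simp add: vball_def)

lemma vball_add: "x \<in> vball s \<Longrightarrow> y \<in> vball s \<Longrightarrow> x + y \<in> vball s" for x :: "'a::monoid_add fls"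
  by (simp add: vball_def)

lemma vball_diff: "x \<in> vball s \<Longrightarrow> y \<in> vball s \<Longrightarrow> x - y \<in> vball s" for x :: "'a::group_add fls"
  by (simp add: vball_def)

lemma vball_mono: "s \<le> s' \<Longrightarrow> vball s' \<subseteq> vball s"
  by (auto simp: vball_def)

lemma vball_antimono: "x \<in> vball s' \<Longrightarrow> s \<le> s' \<Longrightarrow> x \<in> vball s"
  using vball_mono by blast

lemma vball_mult_iff:
  fixes x y :: "'a::field fls"
  assumes "y \<noteq> 0"
  shows "x * y \<in> vball s \<longleftrightarrow> x \<in> vball (s - fls_subdegree y)"
  using assms by (cases "x = 0") (auto simp: vball_iff)

lemma vball_divide_iff:
  fixes x y :: "'a::field fls"
  assumes "y \<noteq> 0"
  shows "x / y \<in> vball s \<longleftrightarrow> x \<in> vball (s + fls_subdegree y)"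
  using vball_mult_iff[OF assms, of "x / y" "s + fls_subdegree y"] assms by simp

lemma laurent_abs_less_iff:
  "laurent_abs (\<Theta> :: 'a::{field,finite} fls) < real CARD('a) powi (- s) \<longleftrightarrow> \<Theta> \<in> vball s"
proof -
  have "1 < real CARD('a)" using card_field_ge_2[where 'a='a] by simp
  then have "real CARD('a) powi (- fls_subdegree \<Theta>) < real CARD('a) powi (- s) \<longleftrightarrow> s < fls_subdegree \<Theta>"
    using power_int_strict_increasing[of "- fls_subdegree \<Theta>" "- s" "real CARD('a)"]
      power_int_increasing[of "- s" "- fls_subdegree \<Theta>" "real CARD('a)"]
    by (cases "s < fls_subdegree \<Theta>") auto
  moreover have "0 < real CARD('a) powi (- s)" by (simp add: zero_less_power_int)
  ultimately show ?thesis
    by (auto simp: laurent_abs_def vball_iff)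
qed

lemma laurent_abs_nonneg: "0 \<le> laurent_abs \<Theta>"
  by (simp add: laurent_abs_def zero_le_power_int)

lemma unit_interval_eq: "unit_interval = vball 0"
  using laurent_abs_less_iff[where s=0] by (auto simp: unit_interval_def)

section \<open>Polynomials, integer parts and fractional parts\<close>

lemma laurent_of_poly_0 [simp]: "laurent_of_poly 0 = 0"
  by (simp add: laurent_of_poly_def)

lemma laurent_of_poly_pCons:
  "laurent_of_poly (pCons a p) = fls_const a + fls_X_inv * laurent_of_poly p"
  by (simp add: laurent_of_poly_def map_poly_pCons)

lemma laurent_of_poly_nth:
  "fls_nth (laurent_of_poly p) i = (if i \<le> 0 then coeff p (nat (- i)) else 0)"
proof (induction p arbitrary: i)
  case (pCons a p)
  show ?case
    by (auto simp: laurent_of_poly_pCons fls_X_inv_times_conv_shift pCons.IH coeff_pCons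
        split: nat.split intro!: arg_cong[where f="coeff p"])
qed simp

lemma laurent_of_poly_add: "laurent_of_poly (p + q) = laurent_of_poly p + laurent_of_poly q"
  by (rule fls_eqI) (simp add: laurent_of_poly_nth)

lemma laurent_of_poly_diff: "laurent_of_poly (p - q) = laurent_of_poly p - laurent_of_poly q"
  by (rule fls_eqI) (simp add: laurent_of_poly_nth)

lemma laurent_of_poly_smult: "laurent_of_poly (smult a p) = fls_const a * laurent_of_poly p"
  by (rule fls_eqI) (simp add: laurent_of_poly_nth)

lemma laurent_of_poly_mult: "laurent_of_poly (p * q) = laurent_of_poly p * laurent_of_poly q"
proof (induction p)
  case (pCons a p)
  then show ?case
    by (simp add: laurent_of_poly_pCons laurent_of_poly_add laurent_of_poly_smult algebra_simps)
qed simp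

lemma laurent_of_poly_eq_0_iff [simp]: "laurent_of_poly p = 0 \<longleftrightarrow> p = 0"
proof
  assume "laurent_of_poly p = 0"
  then have "coeff p n = 0" for n
    using laurent_of_poly_nth[of p "- int n"] by simp
  then show "p = 0" by (simp add: poly_eq_iff)
qed simp

lemma fls_subdegree_laurent_of_poly: "fls_subdegree (laurent_of_poly p) = - int (degree p)"
proof (cases "p = 0")
  case False
  then show ?thesis
    by (intro fls_subdegree_eqI) (auto simp: laurent_of_poly_nth intro!: coeff_eq_0)
qed simp

lemma laurent_of_poly_vball_iff:
  "laurent_of_poly p \<in> vball s \<longleftrightarrow> p = 0 \<or> int (degree p) < - s"
  by (auto simp: vball_iff fls_subdegree_laurent_of_poly)

lemma laurent_abs_laurent_of_poly:
  "p \<noteq> 0 \<Longrightarrow> laurent_abs (laurent_of_poly p :: 'a::{field,finite} fls) = real CARD('a) ^ degree p"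
  by (simp add: laurent_abs_def fls_subdegree_laurent_of_poly)

text \<open>\<open>fls_prpart\<close> keeps only the positive powers of t, hence the separate
  constant term.\<close>

definition int_part :: "'a::field fls \<Rightarrow> 'a poly" where
  "int_part \<Theta> = fls_prpart \<Theta> + [:fls_nth \<Theta> 0:]"

lemma frac_part_nth: "fls_nth (frac_part \<Theta>) i = (if i \<le> 0 then 0 else fls_nth \<Theta> i)"
  by (simp add: frac_part_def)

lemma frac_part_eq: "frac_part \<Theta> = \<Theta> - laurent_of_poly (int_part \<Theta>)"
  by (rule fls_eqI) (simp add: frac_part_nth laurent_of_poly_nth int_part_def coeff_pCons split: nat.split)

lemma frac_part_vball_0: "frac_part \<Theta> \<in> vball 0"
  by (simp add: vball_def frac_part_nth)

lemma frac_part_add_poly: "frac_part (laurent_of_poly p + \<Theta>) = frac_part \<Theta>"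
  by (rule fls_eqI) (simp add: frac_part_nth laurent_of_poly_nth)

lemma frac_part_id: "\<Theta> \<in> vball 0 \<Longrightarrow> frac_part \<Theta> = \<Theta>"
  by (rule fls_eqI) (simp add: frac_part_nth vball_def)

lemma frac_part_diff: "frac_part (x - y) = frac_part x - frac_part y"
  by (rule fls_eqI) (simp add: frac_part_nth)

lemma frac_part_vball: "\<Theta> \<in> vball s \<Longrightarrow> frac_part \<Theta> \<in> vball s"
  by (simp add: vball_def frac_part_nth)

definition approx_set :: "'a::field poly \<Rightarrow> nat \<Rightarrow> 'a fls set" where
  "approx_set N s = {\<Theta> \<in> vball 0. frac_part (\<Theta> * laurent_of_poly N) \<in> vball (int s)}"

text \<open>The subgroup property turns measure bounds into counting: translates by points whose
  differences avoid the subgroup are disjoint.\<close>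

lemma approx_set_diff:
  "x \<in> approx_set N s \<Longrightarrow> y \<in> approx_set N s \<Longrightarrow> x - y \<in> approx_set N s"
  by (simp add: approx_set_def left_diff_distrib frac_part_diff vball_diff)

section \<open>Bezout identities for polynomials\<close>

lemma euclid:
  fixes p q :: "'a::field poly"
  assumes "p \<noteq> 0 \<or> q \<noteq> 0"
  obtains g a b c d where "g \<noteq> 0" "p = g * a" "q = g * b" "c * a + d * b = 1"
proof -
  have "\<exists>g a b c d. g \<noteq> 0 \<and> p = g * a \<and> q = g * b \<and> c * a + d * b = 1"
    using assms
  \<comment> \<open>Zero and the nonzero constants all have degree 0; \<open>Suc\<close> makes the
    measure drop when a constant leaves remainder zero.\<close>
  proof (induction "if q = 0 then 0 else Suc (degree q)" arbitrary: p q rule: less_induct)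
    case less
    show ?case
    proof (cases "q = 0")
      case True
      then have "p \<noteq> 0 \<and> p = p * 1 \<and> q = p * 0 \<and> 1 * 1 + 0 * 0 = (1::'a poly)"
        using less.prems by simp
      then show ?thesis by blast
    next
      case False
      have "(if p mod q = 0 then 0 else Suc (degree (p mod q))) < (if q = 0 then 0 else Suc (degree q))"
        using False degree_mod_less[of q p] by auto
      then obtain g a b c d where g: "g \<noteq> 0" "q = g * a" "p mod q = g * b" "c * a + d * b = 1"
        using less.hyps[of "p mod q" q] False by blast
      have "p = p div q * q + p mod q" by simp
      also have "\<dots> = g * (p div q * a + b)" using g(2,3) by (simp add: algebra_simps)
      finally have "p = g * (p div q * a + b)" .
      moreover have "d * (p div q * a + b) + (c - d * (p div q)) * a = 1"
        using g(4) by (simp add: algebra_simps)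
      ultimately show ?thesis using g(1,2) by blast
    qed
  qed
  with that show thesis by blast
qed

text \<open>Coprimality as an explicit identity: its coefficient c is the inverse of a modulo b that
  \<open>simultaneous_approximation\<close> needs.\<close>

definition comaximal :: "'a::comm_ring_1 \<Rightarrow> 'a \<Rightarrow> bool" where
  "comaximal a b \<longleftrightarrow> (\<exists>c d. c * a + d * b = 1)"

lemma comaximal_commute: "comaximal a b \<longleftrightarrow> comaximal b a"
  unfolding comaximal_def by (metis add.commute)

lemma comaximal_mult:
  assumes "comaximal a b" "comaximal a b'"
  shows "comaximal a (b * b')"
proof -
  obtain c d c' d' where "c * a + d * b = 1" "c' * a + d' * b' = 1"
    using assms unfolding comaximal_def by blast
  then have "(c * a + d * b) * (c' * a + d' * b') = 1" by simp
  then have "(c * c' * a + c * d' * b' + d * b * c') * a + (d * d') * (b * b') = 1"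
    by (simp add: algebra_simps)
  then show ?thesis unfolding comaximal_def by blast
qed

lemma comaximal_power: "comaximal a b \<Longrightarrow> comaximal a (b ^ n)"
proof (induction n)
  case 0
  have "0 * a + 1 * b ^ 0 = 1" by simp
  then show ?case unfolding comaximal_def by blast
qed (simp add: comaximal_mult)

lemma comaximal_dvd_mult:
  assumes "comaximal a b" "a dvd c * b"
  shows "a dvd c"
proof -
  obtain x y where xy: "x * a + y * b = 1" using assms(1) unfolding comaximal_def by blast
  have "a dvd (x * c) * a + y * (c * b)" using assms(2) by simp
  also have "(x * c) * a + y * (c * b) = c * (x * a + y * b)" by (simp add: algebra_simps)
  finally show ?thesis by (simp add: xy)
qed

lemma comaximal_common_divisor: "comaximal a b \<Longrightarrow> c dvd a \<Longrightarrow> c dvd b \<Longrightarrow> c dvd 1"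
  unfolding comaximal_def by (metis dvd_add dvd_mult)

text \<open>Solving for \<open>\<Theta> = (\<Phi>' + p) / N'\<close> turns the condition on \<open>N\<close> into a congruence for \<open>p\<close>
  modulo the cofactor \<open>b\<close>, which is solvable to precision \<open>degree b\<close>.\<close>

lemma simultaneous_approximation:
  fixes N N' :: "'a::field poly"
  assumes N: "N = g * a" "N' = g * b" "N' \<noteq> 0" and ab: "comaximal a b" and s: "s \<le> degree b"
    and \<Phi>': "\<Phi>' \<in> vball 0"
  obtains \<Theta> where "\<Theta> \<in> vball 0" "frac_part (\<Theta> * laurent_of_poly N) - frac_part \<Phi> \<in> vball (int s)"
    "frac_part (\<Theta> * laurent_of_poly N') = \<Phi>'"
proof -
  let ?P = laurent_of_poly
  obtain c d where cd: "c * a + d * b = 1" using ab unfolding comaximal_def by blast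
  have nz: "?P g \<noteq> 0" "?P b \<noteq> 0" "?P N' \<noteq> 0" "b \<noteq> 0" using N by auto
  \<comment> \<open>With \<Theta> = (\<Phi>' + p) / N' one has \<Theta> N = (\<Phi>' + p) a / b, so
    p a / b should agree with \<Psi> modulo polynomials. Rounding \<Psi> b to its integer part u
    costs less than 1 / |b| after division by b. The congruence p a = u modulo b is solved by p = c
    u, and reduction modulo b keeps \<Theta> in the unit interval.\<close>
  define \<Psi> where "\<Psi> = \<Phi> - \<Phi>' * ?P a / ?P b"
  define u where "u = int_part (\<Psi> * ?P b)"
  define p where "p = (c * u) mod b"
  define \<Theta> where "\<Theta> = (\<Phi>' + ?P p) / ?P N'"
  have "\<Theta> * ?P N' = ?P p + \<Phi>'" using nz(3) by (simp add: \<Theta>_def)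
  then have 1: "frac_part (\<Theta> * ?P N') = \<Phi>'"
    by (simp only: frac_part_add_poly frac_part_id[OF \<Phi>'])
  have "p = 0 \<or> degree p < degree b"
    using degree_mod_less[OF nz(4), of "c * u"] by (auto simp: p_def)
  moreover have "degree b \<le> degree N'" using N by (simp add: dvd_imp_degree_le)
  ultimately have "?P p \<in> vball (- int (degree N'))"
    by (auto simp: laurent_of_poly_vball_iff)
  moreover have "\<Phi>' \<in> vball (- int (degree N'))" using \<Phi>' vball_mono[of "- int (degree N')" 0] by auto
  ultimately have 2: "\<Theta> \<in> vball 0"
    unfolding \<Theta>_def vball_divide_iff[OF nz(3)] by (simp add: fls_subdegree_laurent_of_poly vball_add)
  have "p * a = c * u * a - (c * u div b) * b * a"
    unfolding p_def by (simp add: minus_div_mult_eq_mod[symmetric] algebra_simps)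
  also have "c * u * a = u - d * b * u"
  proof -
    have "c * a = 1 - d * b" using cd by (simp add: eq_diff_eq)
    moreover have "c * u * a = (c * a) * u" by (simp add: ac_simps)
    ultimately show ?thesis by (simp add: left_diff_distrib)
  qed
  finally have pa: "p * a = u + (- d * u - (c * u div b) * a) * b" by (simp add: algebra_simps)
  define w where "w = - d * u - (c * u div b) * a"
  have "\<Theta> * ?P N = (\<Phi>' + ?P p) * ?P a / ?P b"
    using nz(1-3) N unfolding \<Theta>_def by (simp add: laurent_of_poly_mult field_simps)
  also have "\<dots> = \<Phi>' * ?P a / ?P b + ?P (p * a) / ?P b"
    by (simp add: laurent_of_poly_mult field_simps add_divide_distrib)
  also have "?P (p * a) / ?P b = ?P w + ?P u / ?P b"
    unfolding pa w_def[symmetric] laurent_of_poly_add laurent_of_poly_mult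
    using nz by (simp add: field_simps)
  also have "?P u = \<Psi> * ?P b - frac_part (\<Psi> * ?P b)" by (simp add: u_def frac_part_eq)
  also have "(\<Psi> * ?P b - frac_part (\<Psi> * ?P b)) / ?P b = \<Psi> - frac_part (\<Psi> * ?P b) / ?P b"
    using nz by (simp add: field_simps)
  finally have eq: "\<Theta> * ?P N = ?P w + (\<Phi> - frac_part (\<Psi> * ?P b) / ?P b)"
    by (simp add: \<Psi>_def)
  have "frac_part (\<Psi> * ?P b) / ?P b \<in> vball (int (degree b))"
    unfolding vball_divide_iff[OF nz(2)] by (simp add: fls_subdegree_laurent_of_poly frac_part_vball_0)
  then have small: "frac_part (\<Psi> * ?P b) / ?P b \<in> vball (int s)"
    using vball_mono[of "int s" "int (degree b)"] s by auto
  have "frac_part (\<Theta> * ?P N) - frac_part \<Phi> = 0 - frac_part (frac_part (\<Psi> * ?P b) / ?P b)"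
    unfolding eq frac_part_add_poly by (simp add: frac_part_diff)
  then have 3: "frac_part (\<Theta> * ?P N) - frac_part \<Phi> \<in> vball (int s)"
    by (simp only: vball_diff[OF vball_zero frac_part_vball[OF small]])
  show thesis by (rule that[OF 2 3 1])
qed

text \<open>Balls of radius q^-s / |N| around the reduced fractions Q/N in the unit interval. The
  degree condition makes the set empty for constant N, which is why \<open>approx_union\<close>
  below uses the exponent \<open>Suc v\<close>.\<close>

definition reduced_approx_set :: "'a::field poly \<Rightarrow> nat \<Rightarrow> 'a fls set" where
  "reduced_approx_set N s = (\<Union>Q\<in>{Q. degree Q < degree N \<and> comaximal Q N}.
     (+) (laurent_of_poly Q / laurent_of_poly N) ` vball (int (s + degree N)))"

lemma reduced_approx_setE:
  assumes "\<Theta> \<in> reduced_approx_set N s"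
  obtains Q where "degree Q < degree N" "comaximal Q N"
    "\<Theta> * laurent_of_poly N - laurent_of_poly Q \<in> vball (int s)"
proof -
  obtain Q x where Q: "degree Q < degree N" "comaximal Q N" "x \<in> vball (int (s + degree N))"
    "\<Theta> = laurent_of_poly Q / laurent_of_poly N + x"
    using assms unfolding reduced_approx_set_def by auto
  then have nz: "laurent_of_poly N \<noteq> 0" by auto
  then have "\<Theta> * laurent_of_poly N - laurent_of_poly Q = x * laurent_of_poly N"
    unfolding Q(4) by (simp add: field_simps)
  moreover have "x * laurent_of_poly N \<in> vball (int s)"
    unfolding vball_mult_iff[OF nz] using Q(3) by (simp add: fls_subdegree_laurent_of_poly)
  ultimately show thesis using that Q(1,2) by simp
qed

lemma reduced_approx_set_subset: "reduced_approx_set N s \<subseteq> approx_set N s"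
proof
  fix \<Theta> assume A: "\<Theta> \<in> reduced_approx_set N s"
  then obtain Q where Q: "degree Q < degree N"
    "\<Theta> * laurent_of_poly N - laurent_of_poly Q \<in> vball (int s)" by (elim reduced_approx_setE)
  then have nz: "laurent_of_poly N \<noteq> 0" by auto
  let ?x = "\<Theta> * laurent_of_poly N - laurent_of_poly Q"
  have x0: "?x \<in> vball 0" using Q(2) vball_mono[of 0 "int s"] by auto
  have eq: "\<Theta> * laurent_of_poly N = laurent_of_poly Q + ?x" by simp
  have "frac_part (\<Theta> * laurent_of_poly N) = ?x"
    by (subst eq) (simp only: frac_part_add_poly frac_part_id[OF x0])
  moreover have "\<Theta> * laurent_of_poly N \<in> vball (- int (degree N))"
    by (subst eq, intro vball_add)
      (use Q x0 vball_mono[of "- int (degree N)" 0] in \<open>auto simp: laurent_of_poly_vball_iff\<close>)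
  ultimately show "\<Theta> \<in> approx_set N s"
    using Q(2) by (simp add: approx_set_def vball_mult_iff[OF nz] fls_subdegree_laurent_of_poly)
qed

text \<open>Distinct reduced fractions \<open>Q/N\<close> and \<open>Q'/N'\<close> differ by at least the inverse of the
  least common multiple of \<open>N\<close> and \<open>N'\<close>.\<close>

lemma reduced_approx_set_disjoint:
  fixes N N' :: "'a::field poly"
  assumes N: "N = g * a" "N' = g * b" and monic: "lead_coeff N = 1" "lead_coeff N' = 1"
    and ab: "comaximal a b" and neq: "N \<noteq> N'"
    and \<Theta>: "\<Theta> \<in> reduced_approx_set N s" "\<Theta> \<in> reduced_approx_set N' s'"
  shows "s < degree b \<or> s' < degree a"
proof -
  let ?P = laurent_of_poly
  have nz: "g \<noteq> 0" "a \<noteq> 0" "b \<noteq> 0" using N monic by auto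
  obtain Q where Q: "comaximal Q N" "\<Theta> * ?P N - ?P Q \<in> vball (int s)"
    using \<Theta>(1) by (elim reduced_approx_setE)
  obtain Q' where Q': "comaximal Q' N'" "\<Theta> * ?P N' - ?P Q' \<in> vball (int s')"
    using \<Theta>(2) by (elim reduced_approx_setE)
  define w where "w = Q * b - Q' * a"
  \<comment> \<open>If w vanished, Q/N and Q'/N' would be one fraction in lowest terms; the
    cofactors a and b would be units and monicity would give N = N'.\<close>
  have "w \<noteq> 0"
  proof
    assume "w = 0"
    then have eq: "Q * b = Q' * a" by (simp add: w_def)
    have "a dvd Q" using comaximal_dvd_mult[OF ab, of Q] eq by simp
    then have "a dvd 1" using comaximal_common_divisor[OF Q(1)] N(1) by simp
    moreover have "b dvd Q'"
      using comaximal_dvd_mult[of b a Q'] ab eq comaximal_commute by (metis dvd_triv_right)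
    then have "b dvd 1" using comaximal_common_divisor[OF Q'(1)] N(2) by simp
    ultimately obtain x y where "a = [:x:]" "b = [:y:]"
      by (meson is_unit_polyE)
    moreover from this have "x \<noteq> 0" "y \<noteq> 0" using nz by auto
    ultimately have "x * lead_coeff g = y * lead_coeff g" using monic N by simp
    then have "a = b" using nz(1) \<open>a = [:x:]\<close> \<open>b = [:y:]\<close> by simp
    then show False using neq N by simp
  qed
  \<comment> \<open>Both sides are Q N' - Q' N. Since w is nonzero its degree is at least that of g,
    whereas s \<ge> degree b and s' \<ge> degree a would push it strictly below.\<close>
  have "?P (g * w) = (\<Theta> * ?P N' - ?P Q') * ?P N - (\<Theta> * ?P N - ?P Q) * ?P N'"
    unfolding w_def N laurent_of_poly_mult laurent_of_poly_diff by (simp add: algebra_simps)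
  moreover have "(\<Theta> * ?P N' - ?P Q') * ?P N \<in> vball (int s' - int (degree N))"
    using Q'(2) N nz by (subst vball_mult_iff) (auto simp: fls_subdegree_laurent_of_poly)
  moreover have "(\<Theta> * ?P N - ?P Q) * ?P N' \<in> vball (int s - int (degree N'))"
    using Q(2) N nz by (subst vball_mult_iff) (auto simp: fls_subdegree_laurent_of_poly)
  ultimately have "?P (g * w) \<in> vball (min (int s' - int (degree N)) (int s - int (degree N')))"
    by (auto intro!: vball_diff elim: vball_antimono)
  then show ?thesis
    using \<open>w \<noteq> 0\<close> nz N by (auto simp: laurent_of_poly_vball_iff degree_mult_eq)
qed

subsection \<open>Counting reduced fractions\<close>

definition polys_below :: "nat \<Rightarrow> 'a::zero poly set" where
  "polys_below n = {p. \<forall>i\<ge>n. coeff p i = 0}"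

lemma polys_below_0: "polys_below 0 = {0}"
  by (auto simp: polys_below_def poly_eq_iff)

lemma polys_below_iff: "p \<in> polys_below n \<longleftrightarrow> p = 0 \<or> degree p < n"
proof
  assume "p \<in> polys_below n"
  then have "lead_coeff p = 0" if "n \<le> degree p" using that by (simp add: polys_below_def)
  then show "p = 0 \<or> degree p < n" by fastforce
next
  assume "p = 0 \<or> degree p < n"
  then have "coeff p i = 0" if "n \<le> i" for i
    using that coeff_eq_0[of p i] by (cases "p = 0") auto
  then show "p \<in> polys_below n" by (simp add: polys_below_def)
qed

lemma polys_below_Suc: "polys_below (Suc n) = (\<lambda>(a, p). pCons a p) ` (UNIV \<times> polys_below n)"
proof (intro equalityI subsetI)
  fix p :: "'a poly"
  assume p: "p \<in> polys_below (Suc n)"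
  obtain a q where "p = pCons a q" by (cases p)
  have "coeff q i = coeff p (Suc i)" for i by (simp add: \<open>p = pCons a q\<close>)
  with p have "q \<in> polys_below n" by (simp add: polys_below_def)
  then show "p \<in> (\<lambda>(a, p). pCons a p) ` (UNIV \<times> polys_below n)"
    using \<open>p = pCons a q\<close> by auto
qed (auto simp: polys_below_def coeff_pCons split: nat.split)

lemma inj_on_pCons: "inj_on (\<lambda>(a, p). pCons a p) A"
  by (auto simp: inj_on_def)

lemma finite_polys_below: "finite (polys_below n :: 'a::{zero,finite} poly set)"
  by (induction n) (auto simp: polys_below_0 polys_below_Suc)

lemma card_polys_below: "card (polys_below n :: 'a::{zero,finite} poly set) = CARD('a) ^ n"
  by (induction n)
    (simp_all add: polys_below_0 polys_below_Suc card_image[OF inj_on_pCons] card_cartesian_product)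

definition polys_below_nz :: "nat \<Rightarrow> 'a::zero poly set" where
  "polys_below_nz n = {p \<in> polys_below n. coeff p 0 \<noteq> 0}"

lemma card_polys_below_nz:
  "card (polys_below_nz (Suc n) :: 'a::{zero,finite} poly set) = (CARD('a) - 1) * CARD('a) ^ n"
proof -
  have "(polys_below_nz (Suc n) :: 'a poly set) = (\<lambda>(a, p). pCons a p) ` ((UNIV - {0}) \<times> polys_below n)"
    unfolding polys_below_nz_def polys_below_Suc by (force simp: image_iff)
  then show ?thesis
    by (simp add: card_image[OF inj_on_pCons] card_cartesian_product card_polys_below card_Diff_singleton)
qed

text \<open>Monic polynomials prime to t: the cofactors M left when the exact power of t is split
  off N. Scaling N by a nonzero constant does not change its approximation sets, so monic
  representatives avoid repetitions.\<close>

definition monics_nz :: "nat \<Rightarrow> 'a::comm_ring_1 poly set" where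
  "monics_nz m = {M. degree M = m \<and> lead_coeff M = 1 \<and> coeff M 0 \<noteq> 0}"

lemma monics_nz_0: "monics_nz 0 = {1}"
proof (intro equalityI subsetI)
  fix M :: "'a poly"
  assume "M \<in> monics_nz 0"
  then have M: "degree M = 0" "lead_coeff M = 1" unfolding monics_nz_def by blast+
  then obtain a where "M = [:a:]" by (elim degree_eq_zeroE)
  with M(2) show "M \<in> {1}" by (simp add: one_pCons)
qed (simp add: monics_nz_def)

lemma monics_nz_subset: "monics_nz m \<subseteq> polys_below (Suc m)"
  by (auto simp: monics_nz_def polys_below_iff)

lemma finite_monics_nz: "finite (monics_nz m :: 'a::{comm_ring_1,finite} poly set)"
  using finite_polys_below monics_nz_subset by (rule finite_subset[rotated])

lemma monics_nz_Suc:
  "monics_nz (Suc n) = (\<lambda>p. p + monom 1 (Suc n)) ` polys_below_nz (Suc n)"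
proof (intro equalityI subsetI)
  fix p :: "'a poly"
  assume p: "p \<in> monics_nz (Suc n)"
  then have "coeff (p - monom 1 (Suc n)) i = 0" if "i \<ge> Suc n" for i
    using that by (cases "i = Suc n") (auto simp: monics_nz_def coeff_eq_0)
  with p have "p - monom 1 (Suc n) \<in> polys_below_nz (Suc n)"
    by (auto simp: polys_below_nz_def polys_below_def monics_nz_def)
  then show "p \<in> (\<lambda>p. p + monom 1 (Suc n)) ` polys_below_nz (Suc n)"
    by (intro image_eqI[of _ _ "p - monom 1 (Suc n)"]) simp_all
next
  fix p :: "'a poly"
  assume "p \<in> (\<lambda>p. p + monom 1 (Suc n)) ` polys_below_nz (Suc n)"
  then obtain r where r: "r \<in> polys_below_nz (Suc n)" "p = r + monom 1 (Suc n)" by auto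
  then have "degree r < Suc n" by (auto simp: polys_below_nz_def polys_below_iff)
  moreover have "degree (monom (1::'a) (Suc n)) = Suc n" by (simp add: degree_monom_eq)
  ultimately have "degree p = Suc n" unfolding r(2)
    by (subst degree_add_eq_right) simp_all
  then show "p \<in> monics_nz (Suc n)"
    using r \<open>degree r < Suc n\<close> by (simp add: monics_nz_def polys_below_nz_def coeff_eq_0)
qed

lemma card_monics_nz_Suc:
  "card (monics_nz (Suc n) :: 'a::{comm_ring_1,finite} poly set) = (CARD('a) - 1) * CARD('a) ^ n"
  unfolding monics_nz_Suc card_polys_below_nz[symmetric] by (rule card_image) (auto simp: inj_on_def)

text \<open>Excluding a zero constant term costs the factor 1 - 1/q, which is at least 1/2 for every
  q.\<close>

lemma card_monics_nz_ge:
  "CARD('a) ^ m \<le> 2 * card (monics_nz m :: 'a::{field,finite} poly set)"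
proof (cases m)
  case (Suc n)
  have "CARD('a) * CARD('a) ^ n \<le> 2 * (CARD('a) - 1) * CARD('a) ^ n"
    using card_field_ge_2[where 'a='a] by (intro mult_right_mono) auto
  then show ?thesis by (simp add: Suc card_monics_nz_Suc)
qed (simp add: monics_nz_0)

abbreviation t_var :: "'a::comm_ring_1 poly" where
  "t_var \<equiv> [:0, 1:]"

lemma comaximal_t_power:
  fixes p :: "'a::field poly"
  assumes "coeff p 0 \<noteq> 0"
  shows "comaximal p (t_var ^ n)"
proof (rule comaximal_power)
  obtain a q where p: "p = pCons a q" by (cases p)
  with assms have "[:1 / a:] * p + (- smult (1 / a) q) * [:0, 1:] = 1"
    by (simp add: one_pCons)
  then show "comaximal p [:0, 1:]" unfolding comaximal_def by blast
qed

text \<open>D is the greatest common divisor made monic; it inherits a nonzero constant term from p,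
  so the bad pairs can be sorted by D in \<open>monics_nz d\<close>.\<close>

lemma not_comaximal_common_divisor:
  fixes p q :: "'a::field poly"
  assumes "\<not> comaximal p q" "coeff p 0 \<noteq> 0"
  obtains d D where "1 \<le> d" "D \<in> monics_nz d" "D dvd p" "D dvd q"
proof -
  have "p \<noteq> 0" using assms(2) by auto
  then obtain g a b x y where g: "g \<noteq> 0" "p = g * a" "q = g * b" "x * a + y * b = 1"
    using euclid[of p q] by blast
  define D where "D = smult (inverse (lead_coeff g)) g"
  have D: "lead_coeff D = 1" "degree D = degree g" "coeff D 0 \<noteq> 0"
    using g assms(2) by (auto simp: D_def coeff_mult_0)
  have "degree g \<noteq> 0"
  proof
    assume "degree g = 0"
    then obtain k where k: "g = [:k:]" by (elim degree_eq_zeroE)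
    with g(1) have "(smult (1 / k) x) * p + (smult (1 / k) y) * q = 1"
      using g(4) unfolding g(2,3) k by (simp add: algebra_simps)
    then show False using assms(1) unfolding comaximal_def by blast
  qed
  then have "1 \<le> degree g" "D \<in> monics_nz (degree g)"
    using D by (auto simp: monics_nz_def)
  moreover have "D dvd p" "D dvd q" using g unfolding D_def by (auto simp: smult_dvd_iff)
  ultimately show thesis by (rule that)
qed

lemma sum_geometric_nat:
  "(\<Sum>d<n. (q - 1) * q ^ d) + 1 = q ^ n" if "1 \<le> q" for q :: nat
proof (induction n)
  case (Suc n)
  have "(\<Sum>d<Suc n. (q - 1) * q ^ d) + 1 = (q - 1) * q ^ n + q ^ n" using Suc by simp
  also have "\<dots> = ((q - 1) + 1) * q ^ n" by (simp only: distrib_right mult_1)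
  also have "\<dots> = q ^ Suc n" using that by simp
  finally show ?case .
qed simp

text \<open>For m > 0 this is an equality: in j = m - d the sum is geometric, and the term d = m,
  where \<open>monics_nz 0\<close> has the single element 1, supplies the summand that closes the
  geometric sum. It is the union bound over common divisors D of degree d, and shows that they spoil
  at most a q-th of all pairs.\<close>

lemma sum_card_monics_nz:
  "CARD('a) * (\<Sum>d=1..m. card (monics_nz d :: 'a poly set) * card (monics_nz (m - d) :: 'a poly set)
      * CARD('a) ^ (m - d)) \<le> card (monics_nz m :: 'a::{field,finite} poly set) * CARD('a) ^ m"
proof (cases m)
  case (Suc n)
  let ?q = "CARD('a)" and ?s = "\<lambda>d. card (monics_nz d :: 'a poly set)"
  have q: "1 \<le> ?q" by simp
  have "(\<Sum>d=1..m. ?s d * ?s (m - d) * ?q ^ (m - d)) = (\<Sum>j<m. ?s (m - j) * ?s j * ?q ^ j)"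
    by (rule sum.reindex_bij_witness[of _ "\<lambda>j. m - j" "\<lambda>d. m - d"]) auto
  also have "\<dots> = ?s m + (\<Sum>j<n. ?s (n - j) * ?s (Suc j) * ?q ^ Suc j)"
    unfolding Suc by (subst sum.lessThan_Suc_shift) (simp add: monics_nz_0)
  also have "(\<Sum>j<n. ?s (n - j) * ?s (Suc j) * ?q ^ Suc j) = (\<Sum>j<n. (?q - 1) * ?q ^ n * ((?q - 1) * ?q ^ j))"
  proof (rule sum.cong)
    fix j assume "j \<in> {..<n}"
    then obtain i where i: "n = Suc (i + j)" by (metis add.commute less_imp_Suc_add lessThan_iff)
    have "?s (n - j) * ?s (Suc j) * ?q ^ Suc j
        = ((?q - 1) * ?q ^ i) * ((?q - 1) * ?q ^ j) * ?q ^ Suc j"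
      unfolding i by (simp add: card_monics_nz_Suc Suc_diff_le)
    also have "\<dots> = (?q - 1) * ?q ^ n * ((?q - 1) * ?q ^ j)"
      unfolding i by (simp add: power_add ac_simps)
    finally show "?s (n - j) * ?s (Suc j) * ?q ^ Suc j = (?q - 1) * ?q ^ n * ((?q - 1) * ?q ^ j)" .
  qed simp
  also have "\<dots> = ?s m * (\<Sum>j<n. (?q - 1) * ?q ^ j)"
    unfolding Suc card_monics_nz_Suc by (simp only: sum_distrib_left)
  also have "?s m + \<dots> = ?s m * ((\<Sum>j<n. (?q - 1) * ?q ^ j) + 1)" by simp
  also have "\<dots> = ?s m * ?q ^ n" by (simp only: sum_geometric_nat[OF q])
  finally show ?thesis by (simp add: Suc)
qed simp

section \<open>Average number of reduced numerators\<close>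

definition reduced_numerators :: "'a::comm_ring_1 poly \<Rightarrow> 'a poly set" where
  "reduced_numerators N = {Q. degree Q < degree N \<and> comaximal Q N}"

lemma finite_reduced_numerators: "finite (reduced_numerators N :: 'a::{comm_ring_1,finite} poly set)"
  by (rule finite_subset[OF _ finite_polys_below[of "degree N"]])
    (auto simp: reduced_numerators_def polys_below_iff)

lemma monics_nz_nonzero: "M \<in> monics_nz m \<Longrightarrow> M \<noteq> 0"
  by (auto simp: monics_nz_def)

lemma degree_t_power_mult: "M \<noteq> 0 \<Longrightarrow> degree (t_var ^ v * M) = v + degree M" for M :: "'a::field poly"
  by (simp add: degree_mult_eq degree_power_eq)

text \<open>The proportion of reduced numerators of a single N can be arbitrarily small, so the
  bound is for the sum over M. Two losses of a factor 1 - 1/q occur: Q must have a nonzero constant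
  term to be prime to t, and pairs (M, Q) with a common factor are removed.\<close>

lemma card_reduced_numerators:
  fixes v m :: nat
  defines "R \<equiv> \<Sum>M\<in>monics_nz m. card (reduced_numerators (t_var ^ Suc v * M) :: 'a::{field,finite} poly set)"
  shows "(CARD('a) - 1) * (card (monics_nz m :: 'a poly set) * ((CARD('a) - 1) * CARD('a) ^ (v + m))) \<le> CARD('a) * R"
proof -
  let ?q = "CARD('a)" and ?s = "\<lambda>d. card (monics_nz d :: 'a poly set)"
  define pairs where "pairs j = (monics_nz j :: 'a poly set) \<times> (polys_below_nz (Suc (v + j)) :: 'a poly set)" for j
  define good where "good = (SIGMA M:(monics_nz m :: 'a poly set). reduced_numerators (t_var ^ Suc v * M))"
  define bad where "bad = (\<Union>d\<in>{1..m}. (\<lambda>(D, M, Q). (D * M, D * Q)) ` (monics_nz d \<times> pairs (m - d)))"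
  have card_pairs: "card (pairs j) = ?s j * ((?q - 1) * ?q ^ (v + j))" for j
    by (simp add: pairs_def card_cartesian_product card_polys_below_nz)
  have fin_pairs: "finite (pairs j)" for j
    unfolding pairs_def polys_below_nz_def by (simp add: finite_monics_nz finite_polys_below)
  have fin_good: "finite good"
    unfolding good_def by (simp add: finite_monics_nz finite_reduced_numerators)
  have fin_bad: "finite bad"
    unfolding bad_def by (simp add: finite_monics_nz fin_pairs)
  \<comment> \<open>The power of t is harmless because Q has a nonzero constant term. Only a common
    factor D of Q and M can spoil coprimality, and dividing both by D leaves a pair of the same kind
    with m - d in place of m.\<close>
  have "pairs m \<subseteq> good \<union> bad"
  proof
    fix z assume "z \<in> pairs m"
    then obtain M Q where z: "z = (M, Q)" and M: "M \<in> monics_nz m" and Q: "Q \<in> polys_below_nz (Suc (v + m))"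
      by (auto simp: pairs_def)
    have Q0: "Q \<noteq> 0" "coeff Q 0 \<noteq> 0" using Q by (auto simp: polys_below_nz_def)
    show "z \<in> good \<union> bad"
    proof (cases "comaximal Q M")
      case True
      then have "comaximal Q (t_var ^ Suc v * M)"
        by (intro comaximal_mult comaximal_t_power Q0)
      moreover have "degree (t_var ^ Suc v * M) = Suc (v + m)"
        using degree_t_power_mult[OF monics_nz_nonzero[OF M], of "Suc v"] M by (simp add: monics_nz_def)
      moreover have "degree Q < Suc (v + m)" using Q Q0 by (auto simp: polys_below_nz_def polys_below_iff)
      ultimately show ?thesis using M z by (simp add: good_def reduced_numerators_def)
    next
      case False
      obtain d D where D: "1 \<le> d" "D \<in> monics_nz d" "D dvd Q" "D dvd M"
        by (rule not_comaximal_common_divisor[OF False Q0(2)])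
      obtain Q' M' where eq: "Q = D * Q'" "M = D * M'" using D(3,4) by (auto elim!: dvdE)
      have nz: "D \<noteq> 0" "M' \<noteq> 0" "Q' \<noteq> 0" using Q0 eq monics_nz_nonzero[OF M] by auto
      have m: "m = d + degree M'" and degD: "degree D = d"
        using M D(2) nz unfolding monics_nz_def eq by (auto simp: degree_mult_eq)
      have "M' \<in> monics_nz (m - d)"
        using M D(2) nz m unfolding monics_nz_def eq by (auto simp: coeff_mult_0 lead_coeff_mult)
      moreover have "Q' \<in> polys_below_nz (Suc (v + (m - d)))"
        using Q nz m degD unfolding polys_below_nz_def polys_below_iff eq
        by (auto simp: degree_mult_eq coeff_mult_0)
      ultimately have "z \<in> (\<lambda>(D, M, Q). (D * M, D * Q)) ` (monics_nz d \<times> pairs (m - d))"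
        using D(2) unfolding z eq pairs_def by force
      moreover have "d \<in> {1..m}" using D(1) m by simp
      ultimately show ?thesis unfolding bad_def by blast
    qed
  qed
  then have "card (pairs m) \<le> card good + card bad"
    using order.trans[OF card_mono card_Un_le, of good bad] fin_good fin_bad by blast
  moreover have "card good = R"
    unfolding good_def R_def by (simp add: finite_monics_nz finite_reduced_numerators)
  moreover have "card bad \<le> (\<Sum>d=1..m. ?s d * card (pairs (m - d)))"
  proof -
    have "card bad \<le> (\<Sum>d=1..m. card ((\<lambda>(D, M, Q). (D * M, D * Q)) ` (monics_nz d \<times> pairs (m - d))))"
      unfolding bad_def by (rule card_UN_le) simp
    also have "\<dots> \<le> (\<Sum>d=1..m. ?s d * card (pairs (m - d)))"
      by (intro sum_mono order.trans[OF card_image_le])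
        (simp_all add: finite_monics_nz fin_pairs card_cartesian_product)
    finally show ?thesis .
  qed
  moreover have "?q * (\<Sum>d=1..m. ?s d * card (pairs (m - d))) \<le> card (pairs m)"
  proof -
    have "(\<Sum>d=1..m. ?s d * card (pairs (m - d)))
        = (?q - 1) * ?q ^ v * (\<Sum>d=1..m. ?s d * ?s (m - d) * ?q ^ (m - d))"
      unfolding card_pairs sum_distrib_left by (intro sum.cong refl) (simp only: power_add ac_simps)
    then have "?q * (\<Sum>d=1..m. ?s d * card (pairs (m - d)))
        = (?q - 1) * ?q ^ v * (?q * (\<Sum>d=1..m. ?s d * ?s (m - d) * ?q ^ (m - d)))" by simp
    also have "\<dots> \<le> (?q - 1) * ?q ^ v * (?s m * ?q ^ m)"
      by (intro mult_left_mono sum_card_monics_nz) simp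
    also have "\<dots> = card (pairs m)" unfolding card_pairs by (simp add: power_add ac_simps)
    finally show ?thesis .
  qed
  ultimately have pairs_le: "card (pairs m) \<le> R + card bad"
    and bad_le: "?q * card bad \<le> card (pairs m)"
    by (simp, meson mult_le_mono2 order.trans)
  have "?q * card (pairs m) \<le> ?q * (R + card bad)" by (rule mult_le_mono2[OF pairs_le])
  also have "\<dots> \<le> ?q * R + card (pairs m)" using bad_le by (simp add: distrib_left)
  finally have "?q * card (pairs m) \<le> ?q * R + card (pairs m)" .
  moreover have "?q * card (pairs m) = (?q - 1) * card (pairs m) + card (pairs m)"
    by (simp add: mult_eq_if)
  ultimately show ?thesis unfolding card_pairs by linarith
qed

subsection \<open>Measures of approximation sets\<close>

lemma dist_fls_less_iff: "dist x y < inverse (2 ^ n) \<longleftrightarrow> x - y \<in> vball (int n)"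
  for x y :: "'a::ab_group_add fls"
proof (cases "x = y")
  case False
  have "inverse (2 ^ nat d) < inverse (2 ^ n :: real) \<longleftrightarrow> int n < d" if "0 \<le> d" for d
    using that by (auto simp: nat_less_iff zless_nat_eq_int_zless)
  moreover have "inverse (2 ^ n) \<le> (1::real)" by (simp add: inverse_le_1_iff)
  moreover have "(1::real) \<le> 2 ^ k" for k by simp
  ultimately show ?thesis
    using False by (auto simp: dist_fls_def vball_iff not_less intro: order.trans)
qed (auto simp: dist_fls_def)

text \<open>Invariance under \<open>vball (int n)\<close>, that is, being a union of cosets of this
  ball. It implies openness, so measurability of the approximation sets needs no separate
  argument.\<close>

definition periodic :: "nat \<Rightarrow> 'a::ab_group_add fls set \<Rightarrow> bool" where
  "periodic n A \<longleftrightarrow> (\<forall>x\<in>A. \<forall>y\<in>vball (int n). x + y \<in> A)"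

lemma open_periodic: "periodic n A \<Longrightarrow> open A" for A :: "'a::ab_group_add fls set"
proof -
  assume A: "periodic n A"
  have "{y. dist y x < inverse (2 ^ n)} \<subseteq> A" if "x \<in> A" for x
  proof
    fix y assume "y \<in> {y. dist y x < inverse (2 ^ n)}"
    then have "y - x \<in> vball (int n)" by (simp add: dist_fls_less_iff)
    then have "x + (y - x) \<in> A" using A that unfolding periodic_def by blast
    then show "y \<in> A" by simp
  qed
  then show "open A"
    unfolding open_fls_def by (metis inverse_positive_iff_positive zero_less_numeral zero_less_power)
qed

lemma open_fls_vball:
  fixes A :: "'a::ab_group_add fls set"
  assumes "open A" "x \<in> A"
  obtains n where "\<And>y. y - x \<in> vball (int n) \<Longrightarrow> y \<in> A"
proof -
  obtain r where r: "0 < r" "{y. dist y x < r} \<subseteq> A"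
    using assms unfolding open_fls_def by blast
  obtain n where "inverse (2 ^ n) < r"
    using real_arch_pow_inv[of r "1/2"] r(1) by (auto simp: power_divide inverse_eq_divide)
  then have "y \<in> A" if "y - x \<in> vball (int n)" for y
    using that r(2) unfolding dist_fls_less_iff[symmetric] by force
  then show thesis by (rule that)
qed

lemma periodic_vball: "periodic n (vball (int n))"
  by (simp add: periodic_def vball_add)

lemma periodic_translate: "periodic n A \<Longrightarrow> periodic n ((+) x ` A)"
  by (force simp: periodic_def add.assoc)

lemma periodic_UN: "(\<And>i. i \<in> I \<Longrightarrow> periodic n (A i)) \<Longrightarrow> periodic n (\<Union>i\<in>I. A i)"
  by (auto simp: periodic_def)

lemma periodic_Int: "periodic n A \<Longrightarrow> periodic n B \<Longrightarrow> periodic n (A \<inter> B)"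
  by (auto simp: periodic_def)

lemma periodic_mono: "periodic n A \<Longrightarrow> n \<le> n' \<Longrightarrow> periodic n' A"
  unfolding periodic_def using vball_antimono[of _ "int n'" "int n"] by auto

lemma periodic_approx_set: "periodic (s + degree N) (approx_set N s)"
proof (cases "N = 0")
  case False
  show ?thesis unfolding periodic_def
  proof (intro ballI)
    fix x y :: "'a fls" assume x: "x \<in> approx_set N s" and y: "y \<in> vball (int (s + degree N))"
    have "- y * laurent_of_poly N \<in> vball (int s)"
      using False y vball_diff[OF vball_zero y] by (subst vball_mult_iff) (simp_all add: fls_subdegree_laurent_of_poly)
    then have "frac_part (x * laurent_of_poly N) - frac_part (- y * laurent_of_poly N) \<in> vball (int s)"
      using x by (intro vball_diff[OF _ frac_part_vball]) (simp_all add: approx_set_def)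
    then have "frac_part ((x + y) * laurent_of_poly N) \<in> vball (int s)"
      by (simp add: frac_part_diff[symmetric] distrib_right)
    moreover have "y \<in> vball 0" using vball_antimono[OF y] by simp
    ultimately show "x + y \<in> approx_set N s"
      using x vball_add by (auto simp: approx_set_def)
  qed
next
  case True
  have "y \<in> vball 0" if "y \<in> vball (int s)" for y :: "'a fls" using vball_antimono[OF that] by simp
  then show ?thesis using True vball_add frac_part_id[OF vball_zero] by (auto simp: periodic_def approx_set_def)
qed

lemma periodic_reduced_approx_set: "periodic (s + degree N) (reduced_approx_set N s)"
  unfolding reduced_approx_set_def by (intro periodic_UN periodic_translate periodic_vball)

text \<open>The point t^-n p. For p in \<open>polys_below n\<close> these points represent the
  cosets of \<open>vball (int n)\<close> in the unit interval.\<close>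

definition fls_center :: "nat \<Rightarrow> 'a::field poly \<Rightarrow> 'a fls" where
  "fls_center n p = fls_X ^ n * laurent_of_poly p"

lemma fls_center_diff: "fls_center n (p - q) = fls_center n p - fls_center n q"
  by (simp add: fls_center_def laurent_of_poly_diff right_diff_distrib)

lemma fls_center_vball_iff: "fls_center n p \<in> vball (int n) \<longleftrightarrow> p = 0"
proof -
  have "fls_center n p \<in> vball (int n) \<longleftrightarrow> laurent_of_poly p * fls_X ^ n \<in> vball (int n)"
    by (simp add: fls_center_def mult.commute)
  also have "\<dots> \<longleftrightarrow> p = 0" by (subst vball_mult_iff) (simp_all add: laurent_of_poly_vball_iff)
  finally show ?thesis .
qed

lemma fls_center_vball_0: "p \<in> polys_below n \<Longrightarrow> fls_center n p \<in> vball 0"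
  unfolding fls_center_def mult.commute[of "fls_X ^ n"]
  by (subst vball_mult_iff) (auto simp: laurent_of_poly_vball_iff polys_below_iff)

lemma fls_center_separated: "fls_center n p - fls_center n q \<in> vball (int n) \<Longrightarrow> p = q"
  by (simp add: fls_center_diff[symmetric] fls_center_vball_iff)

text \<open>Multiplication by t^n moves the first n coefficients into the integer part, which is the
  p of the coset, and the fractional part becomes the element of the ball.\<close>

lemma vball_0_cover: "vball 0 = (\<Union>p\<in>polys_below n. (+) (fls_center n p) ` vball (int n))"
proof (intro equalityI subsetI)
  fix \<Theta> :: "'a fls" assume \<Theta>: "\<Theta> \<in> vball 0"
  define p where "p = int_part (fls_X_inv ^ n * \<Theta>)"
  have inv: "fls_X ^ n * fls_X_inv ^ n = (1 :: 'a fls)"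
    by (simp add: power_mult_distrib[symmetric] fls_X_times_conv_shift fls_X_inv_conv_shift_1)
  have "coeff p i = fls_nth \<Theta> (int n - int i)" for i
    by (cases i) (simp_all add: p_def int_part_def fls_X_inv_power_times_conv_shift algebra_simps)
  then have "p \<in> polys_below n" using \<Theta> by (simp add: polys_below_def vball_def)
  moreover have "\<Theta> - fls_center n p = (frac_part (fls_X_inv ^ n * \<Theta>)) * fls_X ^ n"
    using inv by (simp add: p_def fls_center_def frac_part_eq algebra_simps flip: mult.assoc)
  then have "\<Theta> - fls_center n p \<in> vball (int n)"
    by (simp add: vball_mult_iff frac_part_vball_0)
  then have "\<Theta> \<in> (+) (fls_center n p) ` vball (int n)"
    by (intro image_eqI[of _ _ "\<Theta> - fls_center n p"]) simp_all
  ultimately show "\<Theta> \<in> (\<Union>p\<in>polys_below n. (+) (fls_center n p) ` vball (int n))" by blast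
next
  fix \<Theta> :: "'a fls" assume "\<Theta> \<in> (\<Union>p\<in>polys_below n. (+) (fls_center n p) ` vball (int n))"
  then obtain p x where "p \<in> polys_below n" "x \<in> vball (int n)" "\<Theta> = fls_center n p + x" by blast
  then show "\<Theta> \<in> vball 0"
    using vball_add[OF fls_center_vball_0] vball_antimono[of x "int n" 0] by simp
qed

text \<open>A Chung-Erdos bound. Instead of the Cauchy-Schwarz inequality it integrates 2 t X - X^2
  \<le> t^2 on the union, which follows from (t - X)^2 \<ge> 0, where X counts the events that
  occur. The weights \<psi> need only dominate the probabilities; c measures how much is
  lost.\<close>

lemma (in prob_space) second_moment_bound:
  fixes \<psi> :: "'i \<Rightarrow> real"
  assumes J: "finite J" and A: "\<And>i. i \<in> J \<Longrightarrow> A i \<in> events"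
    and diag: "\<And>i. i \<in> J \<Longrightarrow> prob (A i) \<le> \<psi> i"
    and off: "\<And>i j. i \<in> J \<Longrightarrow> j \<in> J \<Longrightarrow> i \<noteq> j \<Longrightarrow> prob (A i \<inter> A j) \<le> \<psi> i * \<psi> j"
    and lower: "c * sum \<psi> J \<le> (\<Sum>i\<in>J. prob (A i))" and c: "0 < c" and large: "1 \<le> sum \<psi> J"
  shows "c\<^sup>2 / 2 \<le> prob (\<Union>i\<in>J. A i)"
proof -
  define S where "S = sum \<psi> J"
  define X where "X \<omega> = (\<Sum>i\<in>J. indicator (A i) \<omega> :: real)" for \<omega>
  define U where "U = (\<Union>i\<in>J. A i)"
  \<comment> \<open>With first moment at least c S and second moment at most 2 S^2, this t maximises
    the resulting bound (2 t c S - 2 S^2) / t^2.\<close>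
  define t where "t = 2 * S / c"
  have \<psi>: "0 \<le> \<psi> i" if "i \<in> J" for i using diag[OF that] measure_nonneg[of M "A i"] by linarith
  have U: "U \<in> events" unfolding U_def using J A by auto
  have X2: "(X \<omega>)\<^sup>2 = (\<Sum>i\<in>J. \<Sum>j\<in>J. indicator (A i \<inter> A j) \<omega>)" for \<omega>
    by (simp add: X_def power2_eq_square sum_product indicator_inter_arith)
  have X0: "X \<omega> = 0" if "\<omega> \<notin> U" for \<omega>
    using that unfolding X_def U_def by (intro sum.neutral) auto
  have le: "2 * t * X \<omega> - (X \<omega>)\<^sup>2 \<le> t\<^sup>2 * indicator U \<omega>" for \<omega>
  proof (cases "\<omega> \<in> U")
    case True
    have "0 \<le> (t - X \<omega>)\<^sup>2" by simp
    then show ?thesis using True by (simp add: power2_diff)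
  qed (simp add: X0)
  have int_ind: "integrable M (indicator B :: 'a \<Rightarrow> real)" "(\<integral>\<omega>. indicator B \<omega> \<partial>M) = prob B" if "B \<in> events" for B
  proof -
    have "emeasure M B < \<infinity>" by (simp add: less_top[symmetric])
    then have "has_bochner_integral M (indicator B :: 'a \<Rightarrow> real) (prob B)"
      by (rule has_bochner_integral_real_indicator[OF that])
    then show "integrable M (indicator B :: 'a \<Rightarrow> real)" "(\<integral>\<omega>. indicator B \<omega> \<partial>M) = prob B"
      by (simp_all only: has_bochner_integral_iff)
  qed
  have AB: "A i \<inter> A j \<in> events" if "i \<in> J" "j \<in> J" for i j using A that by blast
  have intX: "integrable M X" "(\<integral>\<omega>. X \<omega> \<partial>M) = (\<Sum>i\<in>J. prob (A i))"
    unfolding X_def using A int_ind by (simp_all add: Bochner_Integration.integral_sum)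
  have intX2: "integrable M (\<lambda>\<omega>. (X \<omega>)\<^sup>2)" "(\<integral>\<omega>. (X \<omega>)\<^sup>2 \<partial>M) = (\<Sum>i\<in>J. \<Sum>j\<in>J. prob (A i \<inter> A j))"
    unfolding X2 using AB int_ind by (simp_all add: Bochner_Integration.integral_sum)
  have "(\<integral>\<omega>. 2 * t * X \<omega> - (X \<omega>)\<^sup>2 \<partial>M) \<le> (\<integral>\<omega>. t\<^sup>2 * indicator U \<omega> \<partial>M)"
    using intX intX2 int_ind[OF U] le by (intro integral_mono) auto
  then have 1: "2 * t * (\<Sum>i\<in>J. prob (A i)) - (\<Sum>i\<in>J. \<Sum>j\<in>J. prob (A i \<inter> A j)) \<le> t\<^sup>2 * prob U"
    using intX intX2 int_ind[OF U] by simp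
  have "(\<Sum>i\<in>J. \<Sum>j\<in>J. prob (A i \<inter> A j)) \<le> (\<Sum>i\<in>J. (\<Sum>j\<in>J. \<psi> i * \<psi> j) + \<psi> i)"
  proof (rule sum_mono)
    fix i assume i: "i \<in> J"
    have "(\<Sum>j\<in>J. prob (A i \<inter> A j)) \<le> (\<Sum>j\<in>J. \<psi> i * \<psi> j + (if j = i then \<psi> i else 0))"
      using i diag off \<psi> by (intro sum_mono) (auto intro: add_increasing)
    also have "\<dots> = (\<Sum>j\<in>J. \<psi> i * \<psi> j) + \<psi> i" using i J by (simp add: sum.distrib)
    finally show "(\<Sum>j\<in>J. prob (A i \<inter> A j)) \<le> (\<Sum>j\<in>J. \<psi> i * \<psi> j) + \<psi> i" .
  qed
  also have "\<dots> = S * S + S" by (simp add: S_def sum.distrib sum_product)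
  \<comment> \<open>The diagonal terms contribute the extra S, which S^2 absorbs because S \<ge>
    1.\<close>
  also have "\<dots> \<le> 2 * S\<^sup>2" using large by (simp add: S_def power2_eq_square)
  finally have 2: "(\<Sum>i\<in>J. \<Sum>j\<in>J. prob (A i \<inter> A j)) \<le> 2 * S\<^sup>2" .
  have S: "1 \<le> S" using large by (simp add: S_def)
  have "2 * t * (c * S) \<le> 2 * t * (\<Sum>i\<in>J. prob (A i))"
    using lower c S by (intro mult_left_mono) (auto simp: t_def S_def)
  moreover have "2 * t * (c * S) = 4 * S\<^sup>2" using c by (simp add: t_def power2_eq_square)
  ultimately have "2 * S\<^sup>2 \<le> t\<^sup>2 * prob U" using 1 2 by linarith
  also have "t\<^sup>2 = 4 * S\<^sup>2 / c\<^sup>2" by (simp add: t_def power_divide power_mult_distrib)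
  finally show ?thesis using S c by (simp add: U_def field_simps)
qed

text \<open>Normalised Haar measure of the compact group \<open>vball 0\<close>: translations stay
  inside the unit interval, and the measure is a probability.\<close>

locale unit_haar = prob_space M for M :: "'a::{field,finite} fls measure" +
  assumes space_eq: "space M = vball 0"
    and open_sets: "\<And>U. open U \<Longrightarrow> U \<subseteq> vball 0 \<Longrightarrow> U \<in> events"
    and translation: "\<And>x A. x \<in> vball 0 \<Longrightarrow> A \<in> events \<Longrightarrow> prob ((+) x ` A) = prob A"
begin

lemma periodic_events: "periodic n A \<Longrightarrow> A \<subseteq> vball 0 \<Longrightarrow> A \<in> events"
  using open_sets open_periodic by blast

lemma translate_subset: "x \<in> vball 0 \<Longrightarrow> A \<subseteq> vball 0 \<Longrightarrow> (+) x ` A \<subseteq> vball 0" for x :: "'a fls"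
  using vball_add by blast

text \<open>Points that are incongruent modulo the subgroup V give disjoint translates of equal
  measure. A full set of representatives determines the measure of V; any other set bounds it by the
  inverse of its size, since the total is at most 1.\<close>

lemma prob_separated_translates:
  fixes f :: "'i \<Rightarrow> 'a fls"
  assumes V: "periodic n V" "V \<subseteq> vball 0" "\<And>x y. x \<in> V \<Longrightarrow> y \<in> V \<Longrightarrow> x - y \<in> V"
    and R: "finite R" "\<And>r. r \<in> R \<Longrightarrow> f r \<in> vball 0"
    and sep: "\<And>r r'. r \<in> R \<Longrightarrow> r' \<in> R \<Longrightarrow> f r - f r' \<in> V \<Longrightarrow> r = r'"
  shows "prob (\<Union>r\<in>R. (+) (f r) ` V) = real (card R) * prob V"
proof -
  have "disjoint_family_on (\<lambda>r. (+) (f r) ` V) R"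
    unfolding disjoint_family_on_def
  proof (intro ballI impI)
    fix r r' assume r: "r \<in> R" "r' \<in> R" "r \<noteq> r'"
    show "(+) (f r) ` V \<inter> (+) (f r') ` V = {}"
    proof (rule ccontr)
      assume "(+) (f r) ` V \<inter> (+) (f r') ` V \<noteq> {}"
      then obtain x y where "x \<in> V" "y \<in> V" "f r + x = f r' + y" by auto
      then have "f r - f r' = y - x" by (simp add: algebra_simps)
      then show False using V(3) \<open>x \<in> V\<close> \<open>y \<in> V\<close> sep r by metis
    qed
  qed
  moreover have "(+) (f r) ` V \<in> events" if "r \<in> R" for r
    by (rule periodic_events[OF periodic_translate[OF V(1)] translate_subset[OF R(2)[OF that] V(2)]])
  ultimately have "prob (\<Union>r\<in>R. (+) (f r) ` V) = (\<Sum>r\<in>R. prob ((+) (f r) ` V))"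
    using R(1) by (intro finite_measure_finite_Union) auto
  also have "\<dots> = (\<Sum>r\<in>R. prob V)"
    using R V periodic_events by (intro sum.cong translation) auto
  finally show ?thesis by simp
qed

lemma vball_subset_0: "vball (int n) \<subseteq> (vball 0 :: 'a fls set)"
  by (rule vball_mono) simp

lemma prob_vball: "prob (vball (int n)) = 1 / real CARD('a) ^ n"
proof -
  have "1 = prob (vball 0)" using prob_space space_eq by simp
  also have "\<dots> = prob (\<Union>p\<in>polys_below n. (+) (fls_center n p) ` vball (int n))"
    by (simp flip: vball_0_cover)
  also have "\<dots> = real (card (polys_below n :: 'a poly set)) * prob (vball (int n))"
    by (intro prob_separated_translates[OF periodic_vball vball_subset_0])
      (simp_all add: vball_diff finite_polys_below fls_center_vball_0 fls_center_separated)
  finally show ?thesis by (simp add: card_polys_below field_simps)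
qed

lemma approx_set_events: "approx_set N s \<in> events"
  by (rule periodic_events[OF periodic_approx_set]) (auto simp: approx_set_def)

lemma reduced_approx_set_events: "reduced_approx_set N s \<in> events"
  using reduced_approx_set_subset
  by (intro periodic_events[OF periodic_reduced_approx_set]) (auto simp: approx_set_def)

text \<open>A packing bound: \<open>simultaneous_approximation\<close> realises every pair of target
  fractional parts, that is q^(s + s') of them, and the resulting points are incongruent modulo the
  intersection, which is a subgroup.\<close>

lemma prob_approx_set_Int_le:
  assumes N: "N = g * a" "N' = g * b" "N' \<noteq> 0" and ab: "comaximal a b" and s: "s \<le> degree b"
  shows "prob (approx_set N s \<inter> approx_set N' s') \<le> 1 / real CARD('a) ^ s * (1 / real CARD('a) ^ s')"
proof -
  let ?P = laurent_of_poly
  let ?V = "approx_set N s \<inter> approx_set N' s'"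
  define R where "R = (polys_below s :: 'a poly set) \<times> (polys_below s' :: 'a poly set)"
  have "\<exists>\<Theta>. \<Theta> \<in> vball 0 \<and> frac_part (\<Theta> * ?P N) - fls_center s (fst r) \<in> vball (int s) \<and>
      frac_part (\<Theta> * ?P N') = fls_center s' (snd r)" if "r \<in> R" for r
  proof -
    have r: "fst r \<in> polys_below s" "snd r \<in> polys_below s'" using that by (auto simp: R_def)
    show ?thesis
      using simultaneous_approximation[OF N ab s fls_center_vball_0[OF r(2)], of "fls_center s (fst r)"]
      unfolding frac_part_id[OF fls_center_vball_0[OF r(1)]] by blast
  qed
  then obtain f where f: "\<And>r. r \<in> R \<Longrightarrow> f r \<in> vball 0"
    "\<And>r. r \<in> R \<Longrightarrow> frac_part (f r * ?P N) - fls_center s (fst r) \<in> vball (int s)"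
    "\<And>r. r \<in> R \<Longrightarrow> frac_part (f r * ?P N') = fls_center s' (snd r)" by metis
  have sep: "r = r'" if "r \<in> R" "r' \<in> R" "f r - f r' \<in> ?V" for r r'
  proof -
    have V: "frac_part (f r * ?P N) - frac_part (f r' * ?P N) \<in> vball (int s)"
      "frac_part (f r * ?P N') - frac_part (f r' * ?P N') \<in> vball (int s')"
      using that(3) by (simp_all add: approx_set_def left_diff_distrib frac_part_diff)
    \<comment> \<open>The first target is met only up to \<open>vball (int s)\<close>, but this is
      the precision to which distinct centers are separated, so the errors can be
      subtracted.\<close>
    have "(frac_part (f r * ?P N) - frac_part (f r' * ?P N)) -
        ((frac_part (f r * ?P N) - fls_center s (fst r)) - (frac_part (f r' * ?P N) - fls_center s (fst r')))
        \<in> vball (int s)"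
      by (intro vball_diff V f that)
    then have "fst r = fst r'" by (intro fls_center_separated[of s]) simp
    moreover have "snd r = snd r'"
      using V(2) by (intro fls_center_separated[of s']) (simp only: f(3) that(1,2))
    ultimately show ?thesis by (simp add: prod_eq_iff)
  qed
  have per: "periodic (max (s + degree N) (s' + degree N')) ?V"
    by (intro periodic_Int periodic_mono[OF periodic_approx_set]) simp_all
  have "real (card R) * prob ?V = prob (\<Union>r\<in>R. (+) (f r) ` ?V)"
    using f(1) sep
    by (intro prob_separated_translates[OF per, symmetric])
      (auto simp: R_def finite_polys_below approx_set_def[of N s] intro: approx_set_diff
        intro!: vball_diff simp: left_diff_distrib frac_part_diff)
  also have "\<dots> \<le> 1" by simp
  finally have "real (card R) * prob ?V \<le> 1" .
  moreover have "card R = CARD('a) ^ s * CARD('a) ^ s'"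
    by (simp add: R_def card_cartesian_product card_polys_below)
  ultimately show ?thesis by (simp add: field_simps)
qed

lemma prob_approx_set_le:
  assumes "N \<noteq> 0"
  shows "prob (approx_set N s) \<le> 1 / real CARD('a) ^ s"
proof -
  have "0 * 1 + 1 * 1 = (1 :: 'a poly)" by simp
  then have one: "comaximal (1 :: 'a poly) 1" unfolding comaximal_def by blast
  have "approx_set N 0 \<inter> approx_set N s = approx_set N s"
    by (auto simp: approx_set_def frac_part_vball_0)
  \<comment> \<open>The instance g = N, a = b = 1 with precision 0 in the first set: that set is the
    whole unit interval and the degree condition reads 0 \<le> 0.\<close>
  then show ?thesis
    using prob_approx_set_Int_le[of N N 1 N 1 0 s] assms one by simp
qed

text \<open>Distinct numerators give fractions at distance at least 1 / |N|, so the balls are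
  disjoint and the measure is exact. This is where the count of reduced numerators becomes a lower
  bound for probabilities.\<close>

lemma prob_reduced_approx_set:
  "prob (reduced_approx_set N s) = real (card (reduced_numerators N)) / real CARD('a) ^ (s + degree N)"
proof -
  let ?P = laurent_of_poly
  have nz: "?P N \<noteq> 0" if "Q \<in> reduced_numerators N" for Q
    using that by (auto simp: reduced_numerators_def)
  have "prob (\<Union>Q\<in>reduced_numerators N. (+) (?P Q / ?P N) ` vball (int (s + degree N)))
      = real (card (reduced_numerators N)) * prob (vball (int (s + degree N)))"
  proof (rule prob_separated_translates[OF periodic_vball vball_subset_0])
    fix Q assume Q: "Q \<in> reduced_numerators N"
    then show "?P Q / ?P N \<in> vball 0"
      by (subst vball_divide_iff[OF nz[OF Q]])
        (auto simp: fls_subdegree_laurent_of_poly laurent_of_poly_vball_iff reduced_numerators_def)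
    fix Q' assume "?P Q / ?P N - ?P Q' / ?P N \<in> vball (int (s + degree N))"
    then have "?P (Q - Q') / ?P N \<in> vball (int (s + degree N))"
      by (simp add: laurent_of_poly_diff diff_divide_distrib)
    then show "Q = Q'"
      by (simp add: vball_divide_iff[OF nz[OF Q]] fls_subdegree_laurent_of_poly laurent_of_poly_vball_iff)
  qed (simp_all add: vball_diff finite_reduced_numerators)
  then show ?thesis
    by (simp only: reduced_approx_set_def reduced_numerators_def prob_vball) simp
qed

text \<open>A nonempty intersection forces one of the two degree conditions; reducedness has then
  done its work and the larger sets \<open>approx_set\<close> already obey the product
  bound.\<close>

lemma prob_reduced_approx_set_Int_le:
  assumes monic: "lead_coeff N = 1" "lead_coeff N' = 1" and neq: "N \<noteq> N'"
  shows "prob (reduced_approx_set N s \<inter> reduced_approx_set N' s')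
    \<le> 1 / real CARD('a) ^ s * (1 / real CARD('a) ^ s')"
proof (cases "reduced_approx_set N s \<inter> reduced_approx_set N' s' = {}")
  case False
  then obtain \<Theta> where \<Theta>: "\<Theta> \<in> reduced_approx_set N s" "\<Theta> \<in> reduced_approx_set N' s'" by blast
  have nz: "N \<noteq> 0" "N' \<noteq> 0" using monic by (metis coeff_0 zero_neq_one)+
  then have "N \<noteq> 0 \<or> N' \<noteq> 0" by simp
  then obtain g a b c d where "g \<noteq> 0" and g: "N = g * a" "N' = g * b" "c * a + d * b = 1"
    by (rule euclid)
  then have ab: "comaximal a b" unfolding comaximal_def by blast
  then have ba: "comaximal b a" by (simp add: comaximal_commute)
  have "prob (reduced_approx_set N s \<inter> reduced_approx_set N' s') \<le> prob (approx_set N s \<inter> approx_set N' s')"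
    using reduced_approx_set_subset[of N s] reduced_approx_set_subset[of N' s']
    by (intro finite_measure_mono) (auto simp: approx_set_events sets.Int)
  also have "\<dots> \<le> 1 / real CARD('a) ^ s * (1 / real CARD('a) ^ s')"
    using reduced_approx_set_disjoint[OF g(1,2) monic ab neq \<Theta>]
  proof
    assume "s < degree b"
    then show ?thesis using prob_approx_set_Int_le[OF g(1,2) nz(2) ab] by simp
  next
    assume "s' < degree a"
    then show ?thesis using prob_approx_set_Int_le[OF g(2,1) nz(1) ba, of s' s] by (simp add: Int_commute mult.commute)
  qed
  finally show ?thesis .
qed simp

end

subsection \<open>The union of the approximation sets in the divergence case\<close>

text \<open>Among multiples of t^(L+1) the degree k = L + j + 1 leaves only j + 1 exponents of t.
  Divergence survives because k \<le> (L + 1) (j + 1).\<close>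

lemma divergent_shifted_sum:
  fixes a :: "nat \<Rightarrow> real"
  assumes a: "\<And>k. 0 \<le> a k" and div: "\<not> summable (\<lambda>k. real k * a k)"
  shows "\<exists>n. B \<le> (\<Sum>j<n. real (Suc j) * a (Suc (L + j)))"
proof (rule ccontr)
  assume "\<nexists>n. B \<le> (\<Sum>j<n. real (Suc j) * a (Suc (L + j)))"
  then have "(\<Sum>j<n. real (Suc j) * a (Suc (L + j))) \<le> B" for n
    by (meson linear)
  then have "summable (\<lambda>j. real (Suc j) * a (Suc (L + j)))"
    by (intro summableI_nonneg_bounded) (simp_all add: a)
  then have "summable (\<lambda>j. real (Suc L) * (real (Suc j) * a (Suc (L + j))))"
    by (rule summable_mult)
  moreover have "norm (real (j + Suc L) * a (j + Suc L)) \<le> real (Suc L) * (real (Suc j) * a (Suc (L + j)))" for j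
  proof -
    have "real (j + Suc L) \<le> real (Suc L) * real (Suc j)" by (simp add: algebra_simps)
    then have "real (j + Suc L) * a (Suc (L + j)) \<le> real (Suc L) * real (Suc j) * a (Suc (L + j))"
      by (rule mult_right_mono) (rule a)
    then show ?thesis by (simp add: a abs_mult ac_simps)
  qed
  ultimately have "summable (\<lambda>j. real (j + Suc L) * a (j + Suc L))"
    by (rule summable_comparison_test')
  then have "summable (\<lambda>k. real k * a k)" by (subst (asm) summable_iff_shift)
  then show False using div by simp
qed

lemma order_t_power_mult:
  fixes M :: "'a::field poly"
  assumes "coeff M 0 \<noteq> 0"
  shows "order 0 (t_var ^ v * M) = v"
proof -
  have "M \<noteq> 0" "order 0 M = 0" using assms by (auto intro!: order_0I simp: poly_0_coeff_0)
  then show ?thesis using order_power_n_n[of "0::'a" v] by (simp add: order_mult)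
qed

lemma t_power_mult_inj:
  fixes M M' :: "'a::field poly"
  assumes "t_var ^ v * M = t_var ^ v' * M'" "coeff M 0 \<noteq> 0" "coeff M' 0 \<noteq> 0"
  shows "v = v' \<and> M = M'"
proof -
  have "v = v'"
    using order_t_power_mult[OF assms(2), of v] order_t_power_mult[OF assms(3), of v'] assms(1) by simp
  then show ?thesis using assms(1) by simp
qed

lemma laurent_of_poly_t_power: "laurent_of_poly (t_var ^ n) = fls_X_inv ^ n"
proof (induction n)
  case 0
  show ?case by (simp add: laurent_of_poly_pCons one_pCons)
next
  case (Suc n)
  then show ?case by (simp add: laurent_of_poly_mult laurent_of_poly_pCons one_pCons)
qed

text \<open>For N = t^(v+1) M of degree k the precision asks for |\<langle>\<Theta> N\<rangle>| < 1
  / (|M| q^(l k)), the condition of W with q^(l k) in the role of f(q^k) / \<epsilon>. The parameter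
  L keeps only multiples of t^(L+1), and \<open>Suc v\<close> makes every N nonconstant.\<close>

definition approx_union :: "(nat \<Rightarrow> nat) \<Rightarrow> nat \<Rightarrow> 'a::field fls set" where
  "approx_union l L = (\<Union>v\<in>{L..}. \<Union>M\<in>{M. coeff M 0 \<noteq> 0}.
     approx_set (t_var ^ Suc v * M) (degree M + l (Suc v + degree M)))"

lemma approx_union_subset_vball: "approx_union l L \<subseteq> vball 0"
  by (auto simp: approx_union_def approx_set_def)

lemma approx_union_antimono: "L \<le> L' \<Longrightarrow> approx_union l L' \<subseteq> approx_union l L"
  unfolding approx_union_def by (intro UN_mono) auto

lemma open_approx_union: "open (approx_union l L)"
  unfolding approx_union_def by (intro open_UN ballI open_periodic[OF periodic_approx_set])

text \<open>Every N in the union is divisible by t^L, so adding t^-L p changes \<Theta> N by a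
  polynomial and leaves its fractional part alone.\<close>

lemma approx_union_translate:
  assumes p: "p \<in> polys_below L" and \<Theta>: "\<Theta> \<in> approx_union l L"
  shows "fls_center L p + \<Theta> \<in> approx_union l L"
proof -
  let ?P = laurent_of_poly
  obtain v M where v: "L \<le> v" and M: "coeff M 0 \<noteq> 0"
    and \<Theta>: "\<Theta> \<in> approx_set (t_var ^ Suc v * M) (degree M + l (Suc v + degree M))"
    using \<Theta> by (auto simp: approx_union_def)
  have "fls_X ^ L * fls_X_inv ^ Suc v = (fls_X_inv ^ (Suc v - L) :: 'a fls)"
    using v by (simp only: fls_X_power_times_conv_shift fls_X_inv_power_conv_shift_1) simp
  then have "fls_center L p * ?P (t_var ^ Suc v * M) = ?P (p * t_var ^ (Suc v - L) * M)"
    unfolding fls_center_def laurent_of_poly_mult laurent_of_poly_t_power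
    by (metis (no_types, opaque_lifting) mult.assoc mult.commute)
  then have "frac_part ((fls_center L p + \<Theta>) * ?P (t_var ^ Suc v * M)) = frac_part (\<Theta> * ?P (t_var ^ Suc v * M))"
    by (simp only: distrib_right frac_part_add_poly)
  then have "fls_center L p + \<Theta> \<in> approx_set (t_var ^ Suc v * M) (degree M + l (Suc v + degree M))"
    using \<Theta> vball_add[OF fls_center_vball_0[OF p]] by (simp add: approx_set_def)
  then show ?thesis using v M by (auto simp: approx_union_def)
qed

context unit_haar
begin

lemma approx_union_events: "approx_union l L \<in> events"
  by (intro open_sets open_approx_union approx_union_subset_vball)

text \<open>The bound must be uniform in L. A finite part of the union is chosen so that the sum of
  the weights \<psi> is at least 1, and then the second moment bound with c = 1/4 gives
  1/32.\<close>

lemma prob_approx_union_ge: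
  assumes div: "\<not> summable (\<lambda>k. real k / real CARD('a) ^ l k)"
  shows "1 / 32 \<le> prob (approx_union l L)"
proof -
  let ?q = "CARD('a)"
  define a where "a k = 1 / real ?q ^ l k" for k
  \<comment> \<open>The threshold is 2 because counting only M with nonzero constant term halves the
    weights at worst, and a total of 1 is wanted.\<close>
  obtain n where n: "2 \<le> (\<Sum>j<n. real (Suc j) * a (Suc (L + j)))"
    using divergent_shifted_sum[of a 2 L] div by (auto simp: a_def)
  \<comment> \<open>The index j stands for the degree L + j + 1 of N and i for the exponent L + i +
    1 of t, so M has degree j - i.\<close>
  define J where "J = (SIGMA j:{..<n}. SIGMA i:{..j}. (monics_nz (j - i) :: 'a poly set))"
  define N where "N = (\<lambda>(j::nat, i, M :: 'a poly). t_var ^ Suc (L + i) * M)"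
  define s where "s = (\<lambda>(j, i, M :: 'a poly). (j - i) + l (Suc (L + j)))"
  define \<psi> where "\<psi> x = 1 / real ?q ^ s x" for x
  have finJ: "finite J" unfolding J_def by (simp add: finite_monics_nz)
  have sum_J: "sum h J = (\<Sum>j<n. \<Sum>i\<le>j. \<Sum>M\<in>monics_nz (j - i). h (j, i, M))" for h :: "_ \<Rightarrow> real"
    unfolding J_def by (simp add: sum.Sigma finite_monics_nz split_def)
  have monic: "lead_coeff (N x) = 1" if "x \<in> J" for x
    using that by (auto simp: J_def N_def monics_nz_def lead_coeff_mult lead_coeff_power)
  have inj: "x = y" if "x \<in> J" "y \<in> J" "N x = N y" for x y
  proof -
    obtain j i M j' i' M' where xy: "x = (j, i, M)" "y = (j', i', M')" by (metis prod_cases3)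
    have J: "i \<le> j" "i' \<le> j'" "M \<in> monics_nz (j - i)" "M' \<in> monics_nz (j' - i')"
      using that(1,2) unfolding xy J_def by auto
    then have "Suc (L + i) = Suc (L + i') \<and> M = M'"
      using that(3) unfolding xy N_def by (intro t_power_mult_inj) (auto simp: monics_nz_def)
    moreover have "j - i = j' - i'" using J(3,4) calculation by (simp add: monics_nz_def)
    ultimately show ?thesis using J(1,2) xy by auto
  qed
  have count: "real (card (monics_nz (j - i) :: 'a poly set)) * real ?q ^ Suc (L + j)
      \<le> 4 * (\<Sum>M\<in>monics_nz (j - i). real (card (reduced_numerators (N (j, i, M)))))" if "i \<le> j" for i j
  proof -
    let ?c = "card (monics_nz (j - i) :: 'a poly set)"
    define R where "R = (\<Sum>M\<in>monics_nz (j - i). card (reduced_numerators (N (j, i, M))))"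
    have R: "(?q - 1) * (?c * ((?q - 1) * ?q ^ (L + j))) \<le> ?q * R"
      using card_reduced_numerators[where 'a='a, of "j - i" "L + i"] that by (simp add: R_def N_def)
    \<comment> \<open>Both factors 1 - 1/q of \<open>card_reduced_numerators\<close> are at least
      1/2; together they give the 4.\<close>
    have "?q \<le> 2 * (?q - 1)" using card_field_ge_2[where 'a='a] by simp
    then have "?q * ?q \<le> (2 * (?q - 1)) * (2 * (?q - 1))" by (rule mult_le_mono) fact
    then have "(?q * ?q) * (?c * ?q ^ (L + j)) \<le> ((2 * (?q - 1)) * (2 * (?q - 1))) * (?c * ?q ^ (L + j))"
      by (rule mult_right_mono) simp
    also have "\<dots> = 4 * ((?q - 1) * (?c * ((?q - 1) * ?q ^ (L + j))))" by simp
    also have "\<dots> \<le> 4 * (?q * R)" using R by simp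
    finally have "?q * (?c * ?q ^ Suc (L + j)) \<le> ?q * (4 * R)" by (simp add: ac_simps)
    then have "?c * ?q ^ Suc (L + j) \<le> 4 * R" by simp
    then have "real (?c * ?q ^ Suc (L + j)) \<le> real (4 * R)" by (simp only: of_nat_le_iff)
    then show ?thesis by (simp add: R_def)
  qed
  have "(1/4)\<^sup>2 / 2 \<le> prob (\<Union>x\<in>J. reduced_approx_set (N x) (s x))"
  proof (rule second_moment_bound[where \<psi>=\<psi>])
    show "finite J" by (rule finJ)
    show "reduced_approx_set (N x) (s x) \<in> events" for x by (rule reduced_approx_set_events)
    show "prob (reduced_approx_set (N x) (s x)) \<le> \<psi> x" if "x \<in> J" for x
    proof -
      have "N x \<noteq> 0" using monic[OF that] by (metis coeff_0 zero_neq_one)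
      then show ?thesis
        using finite_measure_mono[OF reduced_approx_set_subset approx_set_events] prob_approx_set_le
        unfolding \<psi>_def by (meson order.trans)
    qed
    show "prob (reduced_approx_set (N x) (s x) \<inter> reduced_approx_set (N y) (s y)) \<le> \<psi> x * \<psi> y"
      if "x \<in> J" "y \<in> J" "x \<noteq> y" for x y
      unfolding \<psi>_def using that inj monic by (intro prob_reduced_approx_set_Int_le) blast+
    have "1 / 4 * (\<Sum>M\<in>monics_nz (j - i). \<psi> (j, i, M))
        \<le> (\<Sum>M\<in>monics_nz (j - i). prob (reduced_approx_set (N (j, i, M)) (s (j, i, M))))" if "i \<le> j" for i j
    proof -
      define S where "S = j - i + l (Suc (L + j))"
      have deg: "degree (N (j, i, M)) = Suc (L + j)" if "M \<in> monics_nz (j - i)" for M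
        using degree_t_power_mult[OF monics_nz_nonzero[OF that], of "Suc (L + i)"] that \<open>i \<le> j\<close>
        by (simp add: N_def monics_nz_def)
      have "(\<Sum>M\<in>monics_nz (j - i). prob (reduced_approx_set (N (j, i, M)) (s (j, i, M))))
          = (\<Sum>M\<in>monics_nz (j - i). real (card (reduced_numerators (N (j, i, M))))) / real ?q ^ (S + Suc (L + j))"
        unfolding sum_divide_distrib
        by (intro sum.cong refl) (simp only: prob_reduced_approx_set deg s_def S_def prod.case)
      moreover have "1 / 4 * (\<Sum>M\<in>monics_nz (j - i). \<psi> (j, i, M))
          = (real (card (monics_nz (j - i) :: 'a poly set)) * real ?q ^ Suc (L + j)) / 4 / real ?q ^ (S + Suc (L + j))"
        by (simp add: \<psi>_def s_def S_def power_add)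
      ultimately show ?thesis using count[OF that] by (simp only:) (intro divide_right_mono, simp_all)
    qed
    then show "1 / 4 * sum \<psi> J \<le> (\<Sum>x\<in>J. prob (reduced_approx_set (N x) (s x)))"
      unfolding sum_J sum_distrib_left by (rule sum_mono[OF sum_mono]) simp
    have "1 / 2 * a (Suc (L + j)) \<le> (\<Sum>M\<in>monics_nz (j - i). \<psi> (j, i, M))" for i j
    proof -
      have "real ?q ^ (j - i) \<le> 2 * real (card (monics_nz (j - i) :: 'a poly set))"
        using card_monics_nz_ge[where 'a='a, of "j - i"] by (metis of_nat_le_iff of_nat_mult of_nat_numeral of_nat_power)
      then show ?thesis by (simp add: \<psi>_def s_def a_def power_add field_simps)
    qed
    then have "(\<Sum>j<n. \<Sum>i\<le>j. 1 / 2 * a (Suc (L + j))) \<le> sum \<psi> J"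
      unfolding sum_J by (intro sum_mono)
    moreover have "(\<Sum>j<n. \<Sum>i\<le>j. 1 / 2 * a (Suc (L + j))) = 1 / 2 * (\<Sum>j<n. real (Suc j) * a (Suc (L + j)))"
      by (simp add: sum_distrib_left)
    ultimately show "1 \<le> sum \<psi> J" using n by linarith
  qed simp
  also have "(\<Union>x\<in>J. reduced_approx_set (N x) (s x)) \<subseteq> approx_union l L"
  proof (intro UN_least)
    fix x assume x: "x \<in> J"
    obtain j i M where xe: "x = (j, i, M)" by (metis prod_cases3)
    have J: "i \<le> j" "M \<in> monics_nz (j - i)" using x unfolding xe J_def by auto
    then have "degree M = j - i" "coeff M 0 \<noteq> 0" by (simp_all add: monics_nz_def)
    then have "N x = t_var ^ Suc (L + i) * M" "s x = degree M + l (Suc (L + i) + degree M)"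
      using J(1) by (simp_all add: xe N_def s_def)
    then have "approx_set (N x) (s x) \<subseteq> approx_union l L"
      using \<open>coeff M 0 \<noteq> 0\<close> unfolding approx_union_def by (auto intro!: bexI[of _ "L + i"] exI[of _ M])
    then show "reduced_approx_set (N x) (s x) \<subseteq> approx_union l L"
      using reduced_approx_set_subset by blast
  qed
  then have "prob (\<Union>x\<in>J. reduced_approx_set (N x) (s x)) \<le> prob (approx_union l L)"
    by (intro finite_measure_mono approx_union_events)
  finally show ?thesis by (simp add: power2_eq_square)
qed

section \<open>From a uniform proportion in every ball to full measure\<close>

abbreviation fls_ball :: "nat \<Rightarrow> 'a poly \<Rightarrow> 'a fls set" where
  "fls_ball n p \<equiv> (+) (fls_center n p) ` vball (int n)"

lemma fls_ball_subset: "p \<in> polys_below n \<Longrightarrow> fls_ball n p \<subseteq> vball 0"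
  by (intro translate_subset fls_center_vball_0 vball_subset_0)

lemma fls_ball_events: "p \<in> polys_below n \<Longrightarrow> fls_ball n p \<in> events"
  by (intro periodic_events[OF periodic_translate[OF periodic_vball]] fls_ball_subset)

lemma prob_fls_ball: "p \<in> polys_below n \<Longrightarrow> prob (fls_ball n p) = 1 / real CARD('a) ^ n"
  using translation[OF fls_center_vball_0 periodic_events[OF periodic_vball vball_subset_0]] prob_vball
  by simp

text \<open>Translating by a point of a ball of radius \<open>q^-L\<close> whose product with \<open>t^L\<close> is a polynomial
  preserves \<open>approx_union l L\<close>, so this set is equidistributed among these balls.\<close>

lemma prob_fls_ball_approx_union:
  assumes div: "\<not> summable (\<lambda>k. real k / real CARD('a) ^ l k)" and p: "p \<in> polys_below L"
  shows "1 / 32 * prob (fls_ball L p) \<le> prob (fls_ball L p \<inter> approx_union l L)"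
proof -
  let ?F = "approx_union l L :: 'a fls set"
  have V: "vball (int L) \<in> events" by (rule periodic_events[OF periodic_vball vball_subset_0])
  have eq: "prob (fls_ball L r \<inter> ?F) = prob (vball (int L) \<inter> ?F)" if r: "r \<in> polys_below L" for r
  proof -
    have "fls_ball L r \<inter> ?F = (+) (fls_center L r) ` (vball (int L) \<inter> ?F)"
    proof (intro equalityI subsetI)
      fix y assume y: "y \<in> fls_ball L r \<inter> ?F"
      then obtain x where x: "x \<in> vball (int L)" "y = fls_center L r + x" by blast
      have "0 - r \<in> polys_below L" using r by (simp add: polys_below_def)
      then have "fls_center L (0 - r) + y \<in> ?F" using y by (intro approx_union_translate) auto
      then have "x \<in> ?F" unfolding fls_center_diff x(2) by (simp add: fls_center_def)
      then show "y \<in> (+) (fls_center L r) ` (vball (int L) \<inter> ?F)" using x by blast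
    qed (use r in \<open>auto intro: approx_union_translate\<close>)
    then show ?thesis
      using translation[OF fls_center_vball_0[OF r]] V approx_union_events by (simp add: sets.Int)
  qed
  have "?F = vball 0 \<inter> ?F" using approx_union_subset_vball[of l L] by blast
  then have "?F = (\<Union>r\<in>polys_below L. fls_ball L r \<inter> ?F)"
    unfolding vball_0_cover[of L] UN_simps .
  then have "prob ?F = prob (\<Union>r\<in>polys_below L. fls_ball L r \<inter> ?F)" by (rule arg_cong)
  also have "\<dots> \<le> (\<Sum>r\<in>polys_below L. prob (fls_ball L r \<inter> ?F))"
    using fls_ball_events approx_union_events
    by (intro finite_measure_subadditive_finite finite_polys_below) blast
  also have "\<dots> = real CARD('a) ^ L * prob (vball (int L) \<inter> ?F)"
    by (simp add: eq card_polys_below)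
  finally have "1 / 32 \<le> real CARD('a) ^ L * prob (vball (int L) \<inter> ?F)"
    using prob_approx_union_ge[OF div, of L] by linarith
  then show ?thesis unfolding eq[OF p] prob_fls_ball[OF p] by (simp add: field_simps)
qed

text \<open>An elementary replacement for Lebesgue density. Let D be the complement of G and E n the
  union of the level n balls that meet D. Density in each of these balls gives prob D \<le> (1 -
  \<delta>) prob (E n). As G is open, the sets E n decrease to D itself, and the limit prob D \<le>
  (1 - \<delta>) prob D forces prob D = 0.\<close>

lemma prob_eq_1_if_uniformly_dense:
  assumes G: "open G" "G \<subseteq> vball 0" and \<delta>: "0 < \<delta>"
    and dense: "\<And>n p. p \<in> polys_below n \<Longrightarrow> \<delta> * prob (fls_ball n p) \<le> prob (fls_ball n p \<inter> G)"
  shows "prob G = 1"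
proof -
  define D where "D = vball 0 - G"
  define S where "S n = {p \<in> polys_below n. fls_ball n p \<inter> D \<noteq> {}}" for n
  define E where "E n = (\<Union>p\<in>S n. fls_ball n p)" for n
  have Gev: "G \<in> events" by (rule open_sets[OF G])
  have Dev: "D \<in> events" unfolding D_def space_eq[symmetric] using Gev by blast
  have finS: "finite (S n)" for n unfolding S_def by (simp add: finite_polys_below)
  have Eev: "E n \<in> events" for n unfolding E_def using finS fls_ball_events by (auto simp: S_def)
  have E_iff: "\<Theta> \<in> E n \<longleftrightarrow> \<Theta> \<in> vball 0 \<and> (\<exists>x\<in>D. \<Theta> - x \<in> vball (int n))" for \<Theta> n
  proof
    assume "\<Theta> \<in> E n"
    then obtain p y where p: "p \<in> polys_below n" "fls_ball n p \<inter> D \<noteq> {}" "y \<in> vball (int n)" "\<Theta> = fls_center n p + y"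
      by (auto simp: E_def S_def)
    then obtain z where z: "z \<in> vball (int n)" "fls_center n p + z \<in> D" by auto
    have "\<Theta> - (fls_center n p + z) \<in> vball (int n)" using vball_diff[OF p(3) z(1)] p(4) by simp
    then show "\<Theta> \<in> vball 0 \<and> (\<exists>x\<in>D. \<Theta> - x \<in> vball (int n))"
      using z(2) p fls_ball_subset[OF p(1)] by blast
  next
    assume R: "\<Theta> \<in> vball 0 \<and> (\<exists>x\<in>D. \<Theta> - x \<in> vball (int n))"
    then obtain x where x: "x \<in> D" "\<Theta> - x \<in> vball (int n)" by blast
    obtain p y where p: "p \<in> polys_below n" "y \<in> vball (int n)" "\<Theta> = fls_center n p + y"
      using R vball_0_cover[of n, where 'a='a] by auto
    have "y - (\<Theta> - x) \<in> vball (int n)" by (intro vball_diff p x)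
    moreover have "x = fls_center n p + (y - (\<Theta> - x))" using p(3) by simp
    ultimately have "x \<in> fls_ball n p" by (rule rev_image_eqI)
    then have "p \<in> S n" using p(1) x(1) by (auto simp: S_def)
    then show "\<Theta> \<in> E n" using p(2,3) by (auto simp: E_def)
  qed
  have le: "prob D \<le> (1 - \<delta>) * prob (E n)" for n
  proof -
    have "D \<subseteq> (\<Union>p\<in>S n. fls_ball n p - G)"
    proof
      fix x assume x: "x \<in> D"
      then have "x \<in> vball 0" by (simp add: D_def)
      then obtain p where p: "p \<in> polys_below n" "x \<in> fls_ball n p"
        unfolding vball_0_cover[of n] by (rule UN_E)
      then have "p \<in> S n" using x unfolding S_def by blast
      moreover have "x \<in> fls_ball n p - G" using p(2) x by (simp add: D_def)
      ultimately show "x \<in> (\<Union>p\<in>S n. fls_ball n p - G)" by (rule UN_I)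
    qed
    moreover have ev: "fls_ball n p - G \<in> events" if "p \<in> S n" for p
      using that fls_ball_events Gev unfolding S_def by blast
    ultimately have "prob D \<le> prob (\<Union>p\<in>S n. fls_ball n p - G)"
      by (intro finite_measure_mono sets.finite_UN[OF finS])
    also have "\<dots> \<le> (\<Sum>p\<in>S n. prob (fls_ball n p - G))"
      using ev by (intro finite_measure_subadditive_finite[OF finS]) blast
    also have "\<dots> \<le> (\<Sum>p\<in>S n. (1 - \<delta>) * prob (fls_ball n p))"
    proof (rule sum_mono)
      fix p assume "p \<in> S n"
      then have p: "p \<in> polys_below n" by (simp add: S_def)
      have "prob (fls_ball n p - G) = prob (fls_ball n p) - prob (fls_ball n p \<inter> G)"
        using finite_measure_Diff'[OF fls_ball_events[OF p] Gev] .
      then show "prob (fls_ball n p - G) \<le> (1 - \<delta>) * prob (fls_ball n p)"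
        using dense[OF p] by (simp add: algebra_simps)
    qed
    also have "\<dots> = (1 - \<delta>) * (\<Sum>p\<in>S n. prob (fls_ball n p))" by (simp add: sum_distrib_left)
    also have "(\<Sum>p\<in>S n. prob (fls_ball n p)) = (\<Sum>p\<in>S n. 1 / real CARD('a) ^ n)"
      by (intro sum.cong prob_fls_ball) (auto simp: S_def)
    also have "\<dots> = prob (E n)"
      unfolding E_def
      by (subst prob_separated_translates[OF periodic_vball vball_subset_0])
        (use finS in \<open>auto simp: S_def prob_vball vball_diff fls_center_vball_0 fls_center_separated\<close>)
    finally show ?thesis .
  qed
  have "(\<lambda>n. prob (E n)) \<longlonglongrightarrow> prob (\<Inter>n. E n)"
  proof (rule finite_Lim_measure_decseq)
    show "decseq E"
      unfolding decseq_def
    proof (intro allI impI subsetI)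
      fix m n x assume "m \<le> n" "x \<in> E n"
      then show "x \<in> E m"
        unfolding E_iff using vball_antimono[of _ "int n" "int m"] by (meson of_nat_le_iff)
    qed
  qed (use Eev in auto)
  moreover have "(\<Inter>n. E n) = D"
  proof (intro equalityI subsetI)
    fix x assume "x \<in> D"
    then have "x \<in> vball 0" "x - x \<in> vball (int n)" for n by (auto simp: D_def)
    then show "x \<in> (\<Inter>n. E n)" using \<open>x \<in> D\<close> unfolding INT_iff E_iff by blast
  next
    fix \<Theta> assume \<Theta>: "\<Theta> \<in> (\<Inter>n. E n)"
    show "\<Theta> \<in> D"
    proof (rule ccontr)
      assume "\<Theta> \<notin> D"
      then have "\<Theta> \<in> G" using \<Theta> by (auto simp: E_iff D_def)
      then obtain n where n: "\<And>y. y - \<Theta> \<in> vball (int n) \<Longrightarrow> y \<in> G"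
        using open_fls_vball[OF G(1)] by metis
      obtain x where x: "x \<in> D" "\<Theta> - x \<in> vball (int n)" using \<Theta> by (auto simp: E_iff)
      have "0 - (\<Theta> - x) \<in> vball (int n)" by (intro vball_diff x vball_zero)
      then have "x \<in> G" using n[of x] by simp
      then show False using x(1) by (simp add: D_def)
    qed
  qed
  ultimately have "(\<lambda>n. (1 - \<delta>) * prob (E n)) \<longlonglongrightarrow> (1 - \<delta>) * prob D"
    by (intro tendsto_mult_left) simp
  then have "prob D \<le> (1 - \<delta>) * prob D"
    by (rule LIMSEQ_le_const) (use le in blast)
  then have "\<delta> * prob D \<le> 0" by (simp add: algebra_simps)
  then have "prob D = 0" using \<delta> measure_nonneg[of M D] by (simp add: mult_le_0_iff order.antisym)
  moreover have "prob D = 1 - prob G"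
    unfolding D_def space_eq[symmetric] by (rule prob_compl[OF Gev])
  ultimately show ?thesis by simp
qed

text \<open>In a ball of level n the required mass already comes from the smaller set
  \<open>approx_union l n\<close>, for which equidistribution at that level is known.\<close>

lemma prob_approx_union:
  assumes "\<not> summable (\<lambda>k. real k / real CARD('a) ^ l k)"
  shows "prob (approx_union l 0) = 1"
proof (rule prob_eq_1_if_uniformly_dense[OF open_approx_union approx_union_subset_vball])
  fix n and p :: "'a poly" assume p: "p \<in> polys_below n"
  have "prob (fls_ball n p \<inter> approx_union l n) \<le> prob (fls_ball n p \<inter> approx_union l 0)"
    using approx_union_antimono[of 0 n l] fls_ball_events[OF p] approx_union_events
    by (intro finite_measure_mono) auto
  then show "1 / 32 * prob (fls_ball n p) \<le> prob (fls_ball n p \<inter> approx_union l 0)"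
    using prob_fls_ball_approx_union[OF assms p] by linarith
qed simp

end

subsection \<open>The zero-one law for W\<close>

lemma t_abs_power_mult:
  fixes M :: "'a::{field,finite} poly"
  assumes "coeff M 0 \<noteq> 0"
  shows "t_abs (t_var ^ v * M) = 1 / real CARD('a) ^ v"
proof -
  have "t_var ^ v * M \<noteq> 0" using assms by auto
  then have "{j. t_var ^ j dvd t_var ^ v * M} = {..v}"
    using order_divides[of "0::'a" _ "t_var ^ v * M"] order_t_power_mult[OF assms] by auto
  moreover have "Max {..v} = v" by (rule Max_eqI) auto
  ultimately show ?thesis by (simp add: t_abs_def power_int_minus inverse_eq_divide)
qed

lemma t_power_decomposition:
  fixes N :: "'a::field poly"
  assumes "N \<noteq> 0"
  obtains v M where "N = t_var ^ v * M" "coeff M 0 \<noteq> 0"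
proof -
  obtain M where "N = [:- 0, 1:] ^ order 0 N * M" "\<not> [:- 0, 1:] dvd M"
    using order_decomp[OF assms, of 0] by blast
  then show thesis
    using that[of "order 0 N" M] by (simp add: dvd_iff_poly_eq_0 poly_0_coeff_0)
qed

definition t_value :: "(real \<Rightarrow> real) \<Rightarrow> 'a::{field,finite} poly \<Rightarrow> 'a fls \<Rightarrow> real" where
  "t_value f N \<Theta> = f (laurent_abs (laurent_of_poly N)) * laurent_abs (laurent_of_poly N) *
     laurent_abs (frac_part (\<Theta> * laurent_of_poly N)) * t_abs N"

text \<open>The t-adic factor cancels the power of t in |N| and leaves |M|. Hence all exponents v
  contribute equally for a given degree, which produces the weight k in the series.\<close>

lemma t_value_power_mult:
  fixes M :: "'a::{field,finite} poly"
  assumes "coeff M 0 \<noteq> 0"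
  shows "t_value f (t_var ^ v * M) \<Theta> = f (real CARD('a) ^ (v + degree M)) * real CARD('a) ^ degree M *
    laurent_abs (frac_part (\<Theta> * laurent_of_poly (t_var ^ v * M)))"
proof -
  have "M \<noteq> 0" using assms by auto
  then have "laurent_abs (laurent_of_poly (t_var ^ v * M)) = real CARD('a) ^ (v + degree M)"
    by (simp add: laurent_abs_laurent_of_poly degree_t_power_mult)
  then show ?thesis
    by (simp add: t_value_def t_abs_power_mult[OF assms] power_add)
qed

text \<open>The absolute value takes discrete values, so replacing \<open>\<delta>\<close> by a power of \<open>q\<close> costs at most
  a factor \<open>q\<close>.\<close>

lemma frac_part_small_eq_approx_set:
  fixes N :: "'a::{field,finite} poly"
  assumes \<delta>: "0 < \<delta>"
  obtains s where "{\<Theta> \<in> vball 0. laurent_abs (frac_part (\<Theta> * laurent_of_poly N)) < \<delta>} = approx_set N s"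
    "1 / real CARD('a) ^ s \<le> real CARD('a) * \<delta>"
proof -
  let ?q = "real CARD('a)"
  have q: "1 < ?q" using card_field_ge_2[where 'a='a] by simp
  obtain n where n: "(1 / ?q) ^ n < \<delta>"
    using real_arch_pow_inv[OF \<delta>, of "1 / ?q"] q by auto
  \<comment> \<open>Elements of \<open>vball (int s)\<close> have absolute value at most q^(-s-1),
    so \<open>P s\<close> says that the whole ball lies below \<delta>. For the least s the converse
    holds too; if s = 0 it is void, since fractional parts lie in \<open>vball 0\<close>.\<close>
  define P where "P s \<longleftrightarrow> ?q powi (- int s - 1) < \<delta>" for s
  have "?q powi (- int n - 1) \<le> ?q powi (- int n)"
    using q by (intro power_int_increasing) auto
  also have "\<dots> = (1 / ?q) ^ n" by (simp add: power_int_minus power_one_over inverse_eq_divide)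
  finally have "P n" using n by (simp add: P_def)
  define s where "s = (LEAST s. P s)"
  have Ps: "P s" unfolding s_def by (rule LeastI) fact
  have less: "\<not> P s'" if "s' < s" for s' using that not_less_Least unfolding s_def by blast
  have iff: "laurent_abs x < \<delta> \<longleftrightarrow> x \<in> vball (int s)" if x: "x \<in> vball 0" for x :: "'a fls"
  proof
    assume "x \<in> vball (int s)"
    then consider "x = 0" | "x \<noteq> 0" "int s < fls_subdegree x" by (auto simp: vball_iff)
    then show "laurent_abs x < \<delta>"
    proof cases
      case 2
      then have "?q powi (- fls_subdegree x) \<le> ?q powi (- int s - 1)"
        using q by (intro power_int_increasing) auto
      then show ?thesis using 2 Ps by (simp add: laurent_abs_def P_def)
    qed (simp add: laurent_abs_def \<delta>)
  next
    assume small: "laurent_abs x < \<delta>"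
    show "x \<in> vball (int s)"
    proof (rule ccontr)
      assume "x \<notin> vball (int s)"
      then have nz: "x \<noteq> 0" and le: "fls_subdegree x \<le> int s" by (auto simp: vball_iff)
      then have pos: "0 < fls_subdegree x" using x by (auto simp: vball_iff)
      then have "nat (fls_subdegree x - 1) < s" using le by linarith
      moreover have "- int (nat (fls_subdegree x - 1)) - 1 = - fls_subdegree x" using pos by simp
      ultimately have "\<not> ?q powi (- fls_subdegree x) < \<delta>" using less unfolding P_def by metis
      then show False using small nz by (simp add: laurent_abs_def)
    qed
  qed
  have "?q powi (- int s - 1) = 1 / ?q ^ s / ?q"
    using q by (simp add: power_int_diff power_int_minus inverse_eq_divide)
  then have "1 / ?q ^ s / ?q < \<delta>" using Ps by (simp only: P_def)
  then have "1 / ?q ^ s < \<delta> * ?q" using q by (subst (asm) pos_divide_less_eq) simp_all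
  then have "1 / ?q ^ s \<le> ?q * \<delta>" by (simp only: mult.commute less_imp_le)
  then show thesis
    using that[of s] iff[OF frac_part_vball_0] by (simp add: approx_set_def)
qed

text \<open>Sorting by degree leaves finitely many N at a time, which makes the set a finite union
  of approximation sets and prepares a union bound with one term for each k.\<close>

definition t_value_less :: "(real \<Rightarrow> real) \<Rightarrow> nat \<Rightarrow> real \<Rightarrow> 'a::{field,finite} fls set" where
  "t_value_less f k \<epsilon> = {\<Theta> \<in> vball 0. \<exists>N. N \<noteq> 0 \<and> degree N = k \<and> t_value f N \<Theta> < \<epsilon>}"

lemma t_value_less_eq:
  fixes f :: "real \<Rightarrow> real"
  assumes f: "0 < f (real CARD('a) ^ k)"
  shows "t_value_less f k \<epsilon> = (\<Union>v\<in>{..k}. \<Union>M\<in>{M :: 'a::{field,finite} poly. coeff M 0 \<noteq> 0 \<and> degree M = k - v}.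
    {\<Theta> \<in> vball 0. laurent_abs (frac_part (\<Theta> * laurent_of_poly (t_var ^ v * M)))
      < \<epsilon> / (f (real CARD('a) ^ k) * real CARD('a) ^ (k - v))})"
    (is "_ = (\<Union>v\<in>_. \<Union>M\<in>?Ms v. ?A v M)")
proof -
  have value_iff: "t_value f (t_var ^ v * M) \<Theta> < \<epsilon> \<longleftrightarrow>
      laurent_abs (frac_part (\<Theta> * laurent_of_poly (t_var ^ v * M)))
      < \<epsilon> / (f (real CARD('a) ^ k) * real CARD('a) ^ (k - v))"
    if "v \<le> k" "M \<in> ?Ms v" for v M and \<Theta> :: "'a fls"
  proof -
    let ?c = "f (real CARD('a) ^ k) * real CARD('a) ^ (k - v)"
      and ?x = "laurent_abs (frac_part (\<Theta> * laurent_of_poly (t_var ^ v * M)))"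
    have "t_value f (t_var ^ v * M) \<Theta> = ?c * ?x" using that by (simp add: t_value_power_mult)
    moreover have "0 < ?c" using f by simp
    ultimately show ?thesis by (simp only: pos_less_divide_eq mult.commute)
  qed
  show ?thesis
  proof (intro equalityI subsetI)
    fix \<Theta> :: "'a fls" assume "\<Theta> \<in> t_value_less f k \<epsilon>"
    then obtain N :: "'a poly" where N: "\<Theta> \<in> vball 0" "N \<noteq> 0" "degree N = k" "t_value f N \<Theta> < \<epsilon>"
      by (auto simp: t_value_less_def)
    obtain v M where M: "N = t_var ^ v * M" "coeff M 0 \<noteq> 0" using t_power_decomposition[OF N(2)] .
    then have "M \<noteq> 0" by auto
    then have "v \<le> k" "M \<in> ?Ms v" using N(3) M(2) degree_t_power_mult[of M v] unfolding M(1) by auto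
    then have "\<Theta> \<in> ?A v M" using N(1,4) value_iff unfolding M(1) by simp
    then show "\<Theta> \<in> (\<Union>v\<in>{..k}. \<Union>M\<in>?Ms v. ?A v M)" using \<open>v \<le> k\<close> \<open>M \<in> ?Ms v\<close> by blast
  next
    fix \<Theta> :: "'a fls" assume "\<Theta> \<in> (\<Union>v\<in>{..k}. \<Union>M\<in>?Ms v. ?A v M)"
    then obtain v M where M: "v \<le> k" "M \<in> ?Ms v" "\<Theta> \<in> ?A v M" by blast
    then have "M \<noteq> 0" by auto
    then have "t_var ^ v * M \<noteq> 0" "degree (t_var ^ v * M) = k" using M degree_t_power_mult[of M v] by auto
    moreover have "\<Theta> \<in> vball 0" "t_value f (t_var ^ v * M) \<Theta> < \<epsilon>" using M value_iff by auto
    ultimately show "\<Theta> \<in> t_value_less f k \<epsilon>" unfolding t_value_less_def by blast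
  qed
qed

lemma open_t_value_less:
  fixes f :: "real \<Rightarrow> real"
  assumes f: "0 < f (real CARD('a) ^ k)" and \<epsilon>: "0 < \<epsilon>"
  shows "open (t_value_less f k \<epsilon> :: 'a::{field,finite} fls set)"
  unfolding t_value_less_eq[where f=f, OF f]
proof (intro open_UN ballI)
  fix v and M :: "'a poly"
  have "0 < \<epsilon> / (f (real CARD('a) ^ k) * real CARD('a) ^ (k - v))" using f \<epsilon> by simp
  then obtain s where "{\<Theta> \<in> vball 0. laurent_abs (frac_part (\<Theta> * laurent_of_poly (t_var ^ v * M)))
      < \<epsilon> / (f (real CARD('a) ^ k) * real CARD('a) ^ (k - v))} = approx_set (t_var ^ v * M) s"
    by (rule frac_part_small_eq_approx_set)
  then show "open {\<Theta> \<in> vball 0. laurent_abs (frac_part (\<Theta> * laurent_of_poly (t_var ^ v * M)))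
      < \<epsilon> / (f (real CARD('a) ^ k) * real CARD('a) ^ (k - v))}"
    using open_periodic[OF periodic_approx_set] by simp
qed

text \<open>The values are nonnegative, so the infimum is 0 exactly if values below every 1 / (n +
  1) occur. The right-hand side is a countable intersection of open sets, and this gives
  measurability.\<close>

lemma W_eq:
  fixes f :: "real \<Rightarrow> real"
  assumes f: "\<And>k. 0 < f (real CARD('a) ^ k)"
  shows "(W f :: 'a::{field,finite} fls set) = (\<Inter>n. \<Union>k. t_value_less f k (inverse (real (Suc n))))"
proof -
  have nonneg: "0 \<le> t_value f N \<Theta>" if "N \<in> UNIV - {0}" for N :: "'a poly" and \<Theta>
    using that less_imp_le[OF f] laurent_abs_nonneg[of "frac_part (\<Theta> * laurent_of_poly N)"]
    by (simp add: t_value_def laurent_abs_laurent_of_poly t_abs_def zero_le_power_int)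
  have "(INF N\<in>UNIV - {0}. t_value f N \<Theta>) = 0 \<longleftrightarrow> (\<forall>n. \<exists>N. N \<noteq> 0 \<and> t_value f N \<Theta> < inverse (real (Suc n)))"
    for \<Theta> :: "'a fls"
  proof -
    let ?I = "INF N\<in>UNIV - {0 :: 'a poly}. t_value f N \<Theta>"
    \<comment> \<open>The characterisation of \<open>INF\<close> over the reals needs a nonempty
      index set and a lower bound.\<close>
    have ne: "UNIV - {0 :: 'a poly} \<noteq> {}" by (metis DiffI UNIV_I empty_iff one_neq_zero singletonD)
    have bdd: "bdd_below ((\<lambda>N. t_value f N \<Theta>) ` (UNIV - {0}))"
      by (intro bdd_belowI2[where m=0] nonneg)
    have I0: "0 \<le> ?I" by (intro cINF_greatest ne nonneg)
    have less: "?I < e \<longleftrightarrow> (\<exists>N. N \<noteq> 0 \<and> t_value f N \<Theta> < e)" for e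
      using cINF_less_iff[OF ne bdd] by auto
    have "?I = 0 \<longleftrightarrow> (\<forall>n. ?I < inverse (real (Suc n)))"
    proof
      assume "\<forall>n. ?I < inverse (real (Suc n))"
      then have "\<not> 0 < ?I" using reals_Archimedean[of ?I] by (meson less_asym)
      then show "?I = 0" using I0 by linarith
    qed simp
    then show ?thesis unfolding less .
  qed
  then show ?thesis
    unfolding W_def t_value_def[symmetric] unit_interval_eq t_value_less_def by auto
qed

text \<open>For each v there are at most q^(k - v + 1) choices of M, each with probability at most q
  \<epsilon> / (f(q^k) q^(k - v)). The powers of q^(k - v) cancel, and the k + 1 exponents v give
  the factor \<open>Suc k\<close>.\<close>

lemma (in unit_haar) prob_t_value_less_le:
  assumes f: "0 < f (real CARD('a) ^ k)" and \<epsilon>: "0 < \<epsilon>"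
  shows "prob (t_value_less f k \<epsilon>) \<le> real (Suc k) * (real CARD('a))\<^sup>2 * \<epsilon> / f (real CARD('a) ^ k)"
proof -
  let ?q = "real CARD('a)"
  define \<delta> where "\<delta> v = \<epsilon> / (f (?q ^ k) * ?q ^ (k - v))" for v
  define Ms where "Ms v = {M :: 'a poly. coeff M 0 \<noteq> 0 \<and> degree M = k - v}" for v
  define B where "B v M = {\<Theta> \<in> vball 0. laurent_abs (frac_part (\<Theta> * laurent_of_poly (t_var ^ v * M))) < \<delta> v}"
    for v and M :: "'a poly"
  have \<delta>: "0 < \<delta> v" for v using f \<epsilon> by (simp add: \<delta>_def)
  have sub: "Ms v \<subseteq> polys_below (Suc (k - v))" for v by (auto simp: Ms_def polys_below_iff)
  then have finMs: "finite (Ms v)" for v using finite_polys_below finite_subset by blast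
  have cardMs: "real (card (Ms v)) \<le> ?q ^ Suc (k - v)" for v
    using card_mono[OF finite_polys_below sub] unfolding card_polys_below
    by (metis of_nat_le_iff of_nat_power)
  have B: "B v M \<in> events \<and> prob (B v M) \<le> ?q * \<delta> v" if "M \<in> Ms v" for v M
  proof -
    obtain s where s: "B v M = approx_set (t_var ^ v * M) s" "1 / ?q ^ s \<le> ?q * \<delta> v"
      using frac_part_small_eq_approx_set[OF \<delta>] unfolding B_def by blast
    have "t_var ^ v * M \<noteq> 0" using that by (auto simp: Ms_def)
    then have "prob (B v M) \<le> 1 / ?q ^ s" unfolding s(1) by (rule prob_approx_set_le)
    then show ?thesis using s approx_set_events by simp
  qed
  have UB: "(\<Union>M\<in>Ms v. B v M) \<in> events" for v using finMs B by blast
  have "prob (t_value_less f k \<epsilon>) = prob (\<Union>v\<in>{..k}. \<Union>M\<in>Ms v. B v M)"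
    unfolding t_value_less_eq[where f=f, OF f] B_def Ms_def \<delta>_def ..
  also have "\<dots> \<le> (\<Sum>v\<le>k. prob (\<Union>M\<in>Ms v. B v M))"
    using UB by (intro finite_measure_subadditive_finite) auto
  also have "\<dots> \<le> (\<Sum>v\<le>k. ?q\<^sup>2 * \<epsilon> / f (?q ^ k))"
  proof (rule sum_mono)
    fix v
    have "prob (\<Union>M\<in>Ms v. B v M) \<le> (\<Sum>M\<in>Ms v. prob (B v M))"
      using finMs B by (intro finite_measure_subadditive_finite) auto
    also have "\<dots> \<le> (\<Sum>M\<in>Ms v. ?q * \<delta> v)" using B by (intro sum_mono) auto
    also have "\<dots> = real (card (Ms v)) * (?q * \<delta> v)" by simp
    also have "\<dots> \<le> ?q ^ Suc (k - v) * (?q * \<delta> v)"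
      using cardMs \<delta>[of v] by (intro mult_right_mono) auto
    also have "\<dots> = ?q\<^sup>2 * \<epsilon> / f (?q ^ k)" using f by (simp add: \<delta>_def power2_eq_square field_simps)
    finally show "prob (\<Union>M\<in>Ms v. B v M) \<le> ?q\<^sup>2 * \<epsilon> / f (?q ^ k)" .
  qed
  also have "\<dots> = real (Suc k) * ?q\<^sup>2 * \<epsilon> / f (?q ^ k)" by simp
  finally show ?thesis .
qed

lemma (in unit_haar) t_value_less_events:
  "0 < f (real CARD('a) ^ k) \<Longrightarrow> 0 < \<epsilon> \<Longrightarrow> t_value_less f k \<epsilon> \<in> events"
  by (intro open_sets open_t_value_less) (auto simp: t_value_less_def)

lemma (in unit_haar) W_events:
  assumes f: "\<And>k. 0 < f (real CARD('a) ^ k)"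
  shows "W f \<in> events"
proof -
  have "(\<Union>k. t_value_less f k (inverse (real (Suc n)))) \<in> events" for n
    by (intro sets.countable_UN'' t_value_less_events f) auto
  then show ?thesis unfolding W_eq[where f=f, OF f] by (intro sets.countable_INT') auto
qed

text \<open>The smallness comes from \<epsilon> rather than from a tail: the union bound over all
  degrees at level \<epsilon> is already C \<epsilon>, and W lies in that union for every \<epsilon>
  = 1 / (n + 1).\<close>

lemma (in unit_haar) prob_W_eq_0:
  assumes f: "\<And>k. 0 < f (real CARD('a) ^ k)"
    and sum: "summable (\<lambda>k. real k / f (real CARD('a) ^ k))"
  shows "prob (W f) = 0"
proof -
  let ?q = "real CARD('a)"
  define C where "C = (\<Sum>k. real (Suc k) * ?q\<^sup>2 / f (?q ^ k))"
  have "summable (\<lambda>k. (2 * ?q\<^sup>2) * (real k / f (?q ^ k)))" by (intro summable_mult sum)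
  \<comment> \<open>The degree 0 has one exponent v but weight 0 in the given series; it is left out
    of the comparison, which uses k + 1 \<le> 2 k.\<close>
  moreover have "norm (real (Suc k) * ?q\<^sup>2 / f (?q ^ k)) \<le> (2 * ?q\<^sup>2) * (real k / f (?q ^ k))" if "1 \<le> k" for k
  proof -
    have "real (Suc k) * ?q\<^sup>2 / f (?q ^ k) \<le> (2 * real k) * ?q\<^sup>2 / f (?q ^ k)"
      using that less_imp_le[OF f] by (intro divide_right_mono mult_right_mono) auto
    then show ?thesis using less_imp_le[OF f] by (simp add: ac_simps)
  qed
  ultimately have sum': "summable (\<lambda>k. real (Suc k) * ?q\<^sup>2 / f (?q ^ k))"
    by (rule summable_comparison_test')
  have le: "prob (W f) \<le> C * inverse (real (Suc n))" for n
  proof -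
    define \<epsilon> where "\<epsilon> = inverse (real (Suc n))"
    have \<epsilon>: "0 < \<epsilon>" by (simp add: \<epsilon>_def)
    let ?E = "\<lambda>k. t_value_less f k \<epsilon> :: 'a fls set"
    have ev: "range ?E \<subseteq> events" using t_value_less_events[where f=f, OF f \<epsilon>] by blast
    have E: "prob (?E k) \<le> real (Suc k) * ?q\<^sup>2 / f (?q ^ k) * \<epsilon>" for k
      using prob_t_value_less_le[where f=f, OF f \<epsilon>] by simp
    have sumb: "summable (\<lambda>k. real (Suc k) * ?q\<^sup>2 / f (?q ^ k) * \<epsilon>)"
      by (rule summable_mult2[OF sum'])
    have sumE: "summable (\<lambda>k. prob (?E k))"
      by (rule summable_comparison_test'[OF sumb, where N=0]) (simp only: real_norm_def abs_of_nonneg[OF measure_nonneg] E)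
    have "prob (W f) \<le> prob (\<Union>k. ?E k)"
      unfolding W_eq[where f=f, OF f] \<epsilon>_def using ev by (intro finite_measure_mono) (auto simp: \<epsilon>_def)
    also have "\<dots> \<le> (\<Sum>k. prob (?E k))"
      by (rule finite_measure_subadditive_countably[OF ev sumE])
    also have "\<dots> \<le> (\<Sum>k. real (Suc k) * ?q\<^sup>2 / f (?q ^ k) * \<epsilon>)"
      by (rule suminf_le[OF E sumE sumb])
    also have "\<dots> = C * \<epsilon>" unfolding C_def by (rule suminf_mult2[OF sum', symmetric])
    finally show ?thesis by (simp only: \<epsilon>_def)
  qed
  have "(\<lambda>n. C * inverse (real (Suc n))) \<longlonglongrightarrow> C * 0"
    by (intro tendsto_mult tendsto_const LIMSEQ_inverse_real_of_nat)
  then have "prob (W f) \<le> C * 0" by (rule LIMSEQ_le_const) (use le in blast)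
  then show ?thesis using measure_nonneg[of M "W f"] by simp
qed

text \<open>For each fixed \<epsilon> a value below \<epsilon> occurs almost surely, by
  \<open>prob_approx_union\<close> with l rounding f(q^k) / \<epsilon> up to a power of q. Countably
  many \<epsilon> then suffice.\<close>

lemma (in unit_haar) prob_W_eq_1:
  assumes f: "\<And>k. 0 < f (real CARD('a) ^ k)"
    and div: "\<not> summable (\<lambda>k. real k / f (real CARD('a) ^ k))"
  shows "prob (W f) = 1"
proof -
  let ?q = "real CARD('a)"
  have q: "1 < ?q" using card_field_ge_2[where 'a='a] by simp
  have full: "prob (\<Union>k. t_value_less f k \<epsilon>) = 1" if \<epsilon>: "0 < \<epsilon>" for \<epsilon>
  proof -
    define l where "l k = (LEAST n. f (?q ^ k) / \<epsilon> \<le> ?q ^ n)" for k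
    have "\<exists>n. f (?q ^ k) / \<epsilon> \<le> ?q ^ n" for k
      using real_arch_pow[OF q] by (meson less_imp_le)
    then have l: "f (?q ^ k) / \<epsilon> \<le> ?q ^ l k" for k
      unfolding l_def by (rule LeastI_ex)
    have l_less: "?q ^ n < f (?q ^ k) / \<epsilon>" if "n < l k" for n k
      using not_less_Least[OF that[unfolded l_def]] by simp
    have "\<not> summable (\<lambda>k. real k / ?q ^ l k)"
    proof
      assume s: "summable (\<lambda>k. real k / ?q ^ l k)"
      \<comment> \<open>Rounding up costs at most a factor q only if l k > 0, since exponents are
        cut off at 0. Terms with l k = 0 equal k, so for large k convergence of the series excludes
        them.\<close>
      have "eventually (\<lambda>k. real k / ?q ^ l k < 1) sequentially"
        using order_tendstoD(2)[OF summable_LIMSEQ_zero[OF s], of 1] by simp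
      then have "eventually (\<lambda>k. norm (real k / f (?q ^ k)) \<le> ?q / \<epsilon> * (real k / ?q ^ l k)) sequentially"
        using eventually_ge_at_top[of 1]
      proof eventually_elim
        case (elim k)
        have "l k \<noteq> 0" using elim by (intro notI) simp
        then obtain m where m: "l k = Suc m" by (cases "l k") auto
        have "?q ^ l k \<le> ?q * f (?q ^ k) / \<epsilon>" using l_less[of m k] q by (simp add: m mult_left_mono less_imp_le flip: times_divide_eq_right)
        then have "1 / f (?q ^ k) \<le> ?q / \<epsilon> * (1 / ?q ^ l k)"
          using f[of k] \<epsilon> q by (simp add: field_simps)
        then have "real k * (1 / f (?q ^ k)) \<le> real k * (?q / \<epsilon> * (1 / ?q ^ l k))"
          by (rule mult_left_mono) simp
        then show ?case using less_imp_le[OF f[of k]] by (simp add: ac_simps)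
      qed
      moreover have "summable (\<lambda>k. ?q / \<epsilon> * (real k / ?q ^ l k))" by (intro summable_mult s)
      ultimately have "summable (\<lambda>k. real k / f (?q ^ k))" by (rule summable_comparison_test_ev)
      then show False using div by simp
    qed
    then have "prob (approx_union l 0) = 1" by (rule prob_approx_union)
    moreover have "(approx_union l 0 :: 'a fls set) \<subseteq> (\<Union>k. t_value_less f k \<epsilon>)"
    proof
      fix \<Theta> :: "'a fls" assume "\<Theta> \<in> approx_union l 0"
      then obtain v and M :: "'a poly" where M: "coeff M 0 \<noteq> 0"
        and \<Theta>: "\<Theta> \<in> approx_set (t_var ^ Suc v * M) (degree M + l (Suc v + degree M))"
        by (auto simp: approx_union_def)
      define k where "k = Suc v + degree M"
      define x where "x = laurent_abs (frac_part (\<Theta> * laurent_of_poly (t_var ^ Suc v * M)))"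
      have "x < ?q powi (- int (degree M + l k))"
        unfolding x_def laurent_abs_less_iff using \<Theta> by (simp add: approx_set_def k_def)
      then have "x < 1 / (?q ^ degree M * ?q ^ l k)"
        by (simp add: power_int_minus inverse_eq_divide power_add del: of_nat_add)
      then have "f (?q ^ k) * ?q ^ degree M * x < f (?q ^ k) * ?q ^ degree M * (1 / (?q ^ degree M * ?q ^ l k))"
        using f[of k] q by (intro mult_strict_left_mono) auto
      also have "\<dots> = f (?q ^ k) / ?q ^ l k" using q by simp
      also have "\<dots> \<le> \<epsilon>" using l[of k] \<epsilon> q by (simp add: field_simps)
      finally have "t_value f (t_var ^ Suc v * M) \<Theta> < \<epsilon>"
        unfolding t_value_power_mult[OF M] x_def k_def .
      moreover have "M \<noteq> 0" using M by auto
      then have "t_var ^ Suc v * M \<noteq> 0" by simp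
      ultimately have "\<Theta> \<in> t_value_less f (degree (t_var ^ Suc v * M)) \<epsilon>"
        using \<Theta> unfolding t_value_less_def approx_set_def by blast
      then show "\<Theta> \<in> (\<Union>k. t_value_less f k \<epsilon>)" by blast
    qed
    ultimately have "1 \<le> prob (\<Union>k. t_value_less f k \<epsilon>)"
      using finite_measure_mono[of "approx_union l 0" "\<Union>k. t_value_less f k \<epsilon>"] t_value_less_events[where f=f, OF f \<epsilon>] by auto
    then show ?thesis using prob_le_1[of "\<Union>k. t_value_less f k \<epsilon>"] by linarith
  qed
  have ev: "(\<Union>k. t_value_less f k (inverse (real (Suc n)))) \<in> events" for n
    by (intro sets.countable_UN'' t_value_less_events f) auto
  have "AE \<Theta> in M. \<forall>n. \<Theta> \<in> (\<Union>k. t_value_less f k (inverse (real (Suc n))))"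
    unfolding AE_all_countable using prob_eq_1[OF ev] full by simp
  then have "AE \<Theta> in M. \<Theta> \<in> W f" unfolding W_eq[where f=f, OF f] by simp
  then show ?thesis using prob_eq_1[OF W_events[where f=f, OF f]] by blast
qed

section \<open>Haar measure restricted to the unit interval\<close>

lemma unit_interval_borel: "(unit_interval :: 'a::{field,finite} fls set) \<in> sets borel"
  using open_periodic[OF periodic_vball[of 0, where 'a='a]] by (simp add: unit_interval_eq)

lemma unit_haar_restrict_space:
  fixes \<mu> :: "'a::{field,finite} fls measure"
  assumes haar: "haar_measure \<mu>" and norm: "emeasure \<mu> unit_interval = 1"
  shows "unit_haar (restrict_space \<mu> unit_interval)"
proof -
  note haar = haar[unfolded haar_measure_def]
  have sets: "sets \<mu> = sets borel" using haar by (rule conjunct1)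
  have inv: "emeasure \<mu> ((+) x ` A) = emeasure \<mu> A" if "A \<in> sets borel" for x A
    using haar[THEN conjunct2, THEN conjunct1, THEN spec, THEN bspec, OF that] .
  have space: "space \<mu> = UNIV" using sets_eq_imp_space_eq[OF sets] by simp
  have I: "unit_interval \<inter> space \<mu> \<in> sets \<mu>"
    unfolding sets space using unit_interval_borel by simp
  have mem: "A \<in> sets (restrict_space \<mu> unit_interval) \<longleftrightarrow> A \<subseteq> vball 0 \<and> A \<in> sets borel" for A
    using sets_restrict_space_iff[OF I] by (simp add: unit_interval_eq sets)
  have meas: "measure (restrict_space \<mu> unit_interval) A = measure \<mu> A" if "A \<subseteq> vball 0" for A
    using measure_restrict_space[OF I] that by (simp add: unit_interval_eq)
  show ?thesis
  proof (intro unit_haar.intro unit_haar_axioms.intro prob_spaceI)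
    show "emeasure (restrict_space \<mu> unit_interval) (space (restrict_space \<mu> unit_interval)) = 1"
      using emeasure_restrict_space[OF I, of unit_interval] norm by (simp add: space_restrict_space space)
    show "space (restrict_space \<mu> unit_interval) = vball 0"
      by (simp add: space_restrict_space space unit_interval_eq)
    show "U \<in> sets (restrict_space \<mu> unit_interval)" if "open U" "U \<subseteq> vball 0" for U
      using that by (simp add: mem)
    show "measure (restrict_space \<mu> unit_interval) ((+) x ` A) = measure (restrict_space \<mu> unit_interval) A"
      if "x \<in> vball 0" "A \<in> sets (restrict_space \<mu> unit_interval)" for x A
    proof -
      have A: "A \<subseteq> vball 0" "A \<in> sets borel" using that(2) by (simp_all add: mem)
      then have "(+) x ` A \<subseteq> vball 0" using that(1) vball_add by blast
      then show ?thesis using A inv[OF A(2)] by (simp only: meas) (simp only: measure_def)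
    qed
  qed
qed

theorem theorem1p1p3:
  fixes \<mu> :: "'a::{field,finite} fls measure" and f :: "real \<Rightarrow> real"
  assumes haar: "haar_measure \<mu>"
    and normalised: "emeasure \<mu> unit_interval = 1"
    and f_pos: "\<And>x. x \<in> poly_abs_values CARD('a) \<Longrightarrow> f x > 0"
  shows "(W f :: 'a fls set) \<in> sets \<mu> \<and>
    (summable (\<lambda>k::nat. real k / f (real CARD('a) ^ k)) \<longrightarrow>
       emeasure \<mu> (W f) = 0) \<and>
    (\<not> summable (\<lambda>k::nat. real k / f (real CARD('a) ^ k)) \<and>
       mono_on (poly_abs_values CARD('a)) f \<longrightarrow>
       emeasure \<mu> (W f) = 1)"
proof -
  interpret unit_haar "restrict_space \<mu> unit_interval"
    using haar normalised by (rule unit_haar_restrict_space)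
  have f: "0 < f (real CARD('a) ^ k)" for k
    using f_pos by (simp add: poly_abs_values_def)
  have sets: "sets \<mu> = sets borel" using haar[unfolded haar_measure_def] by (rule conjunct1)
  have I: "unit_interval \<inter> space \<mu> \<in> sets \<mu>"
    using sets_eq_imp_space_eq[OF sets] unit_interval_borel by (simp add: sets)
  have W: "W f \<in> sets \<mu>" "W f \<subseteq> (unit_interval :: 'a fls set)"
    using W_events[of f] f sets_restrict_space_iff[OF I] by auto
  have "emeasure \<mu> (W f) = ennreal (prob (W f))"
    using emeasure_restrict_space[OF I W(2)] by (simp add: emeasure_eq_measure)
  then show ?thesis
    using W(1) prob_W_eq_0[of f] prob_W_eq_1[of f] f by simp
qed

end
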